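(* Let $\mathbf p^0=\{p^0_n\}_{n=0}^\infty$ be a probability distribution on $\mathbb N=\{0,1,2,\dots\}$ with mean $\mu=\sum_{n=0}^\infty n p^0_n\in(0,\infty)$. If $\mu\le 1$, assume in addition that the second moment $\sum_{n=0}^\infty n^2p_n^0$ is finite. Then there exists a positive constant $C$, depending only on the second moment of $\mathbf p^0$ when $\mu\le1$, or only on the first moment $\mu$ when $\mu>1$, such that the classical solution $\mathbf p(t)$ of the mean-field dispersion system with initial value $\mathbf p(0)=\mathbf p^0$ satisfies, for all $t>0$: (i) if $0<\mu<1$, then $\|\mathbf p(t)-\mathbf p^*\|_{\ell^1}\le C\,e^{-2(1-\mu)t}$; (ii) if $\mu=1$, then $\|\mathbf p(t)-\mathbf p^*\|_{\ell^1}\le C\,t^{-1}$; and, for $\mu>1$, writing $\nu:=\mu+W_0(-\mu e^{-\mu})$: (iii) if $1<\mu<\frac{e}{e-1}$, then $\|\mathbf p(t)-\overline{\mathbf p}\|_{\ell^1}\le C\,\langle t\rangle^{1/2}e^{-\nu t}$; (iv) if $\mu\ge\frac{e}{e-1}$, then there exists $K>0$ depending only on $\mu$ such that $\|\mathbf p(t)-\overline{\mathbf p}\|_{\ell^1}\le C\,\langle t\rangle^{K+1/2}e^{-t}$. Here $\mathbf p^*=\{1-\mu,\mu,0,0,\dots\}$, and $\overline{\mathbf p}=\{0,\overline p_1,\overline p_2,\dots\}$ with $\overline p_n=\frac{\nu^n}{n!}\cdot\frac{1}{e^\nu-1}$ for $n\ge1$.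
   Context: $\langle t\rangle:=\sqrt{1+t^2}$. $W_0$ is the principal branch of the Lambert $W$ function: for $x\ge -e^{-1}$, $y=W_0(x)$ is the solution $y\ge-1$ of $ye^{y}=x$. Let $\mathcal S$ be the set of probability distributions $\mathbf q=\{q_n\}_{n\ge0}$ on $\mathbb N=\{0,1,2,\dots\}$, and equip it with the norm $\|\mathbf q\|_{\mathcal S}=\sum_{n\ge0}(1+n)|q_n|$ (assumed finite along solutions). The mean-field dispersion system is the infinite ODE system $$p_0'=-a p_0,\qquad p_1'=2p_2-a(p_1-p_0),\qquad p_n'=(n+1)p_{n+1}-np_n-a(p_n-p_{n-1})\ \ (n\ge2),$$ where $a(t)=\sum_{n=2}^\infty n p_n(t)$. A classical solution is a map $\mathbf p:[0,\infty)\to\mathcal S$ with $\mathbf p\in C([0,\infty);\mathcal S)\cap C^1([0,\infty);\ell^\infty)$ (continuity in the norm $\|\cdot\|_{\mathcal S}$) satisfying this system for all $t$. *)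

theory Defs
  imports "HOL-Analysis.Analysis"
begin

definition japanese_bracket :: "real \<Rightarrow> real"
  where "japanese_bracket t = sqrt (1 + t\<^sup>2)"

text \<open>Principal branch of the Lambert function; only meaningful for \<^term>\<open>x \<ge> - exp (- 1)\<close>.\<close>

definition lambert_W0 :: "real \<Rightarrow> real"
  where "lambert_W0 x = (THE y. - 1 \<le> y \<and> y * exp y = x)"

definition prob_dist :: "(nat \<Rightarrow> real) \<Rightarrow> bool"
  where "prob_dist q \<longleftrightarrow> (\<forall>n. 0 \<le> q n) \<and> q sums 1"

definition has_first_moment :: "(nat \<Rightarrow> real) \<Rightarrow> bool"
  where "has_first_moment q \<longleftrightarrow> summable (\<lambda>n. real n * q n)"

definition first_moment :: "(nat \<Rightarrow> real) \<Rightarrow> real"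
  where "first_moment q = (\<Sum>n. real n * q n)"

definition has_second_moment :: "(nat \<Rightarrow> real) \<Rightarrow> bool"
  where "has_second_moment q \<longleftrightarrow> summable (\<lambda>n. (real n)\<^sup>2 * q n)"

definition second_moment :: "(nat \<Rightarrow> real) \<Rightarrow> real"
  where "second_moment q = (\<Sum>n. (real n)\<^sup>2 * q n)"

definition l1_norm :: "(nat \<Rightarrow> real) \<Rightarrow> real"
  where "l1_norm q = (\<Sum>n. \<bar>q n\<bar>)"

definition S_norm :: "(nat \<Rightarrow> real) \<Rightarrow> real"
  where "S_norm q = (\<Sum>n. (1 + real n) * \<bar>q n\<bar>)"

definition S_space :: "(nat \<Rightarrow> real) set"
  where "S_space = {q. prob_dist q \<and> summable (\<lambda>n. (1 + real n) * \<bar>q n\<bar>)}"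

text \<open>The sum of \<open>n * q n\<close> over \<open>n \<ge> 2\<close>.\<close>

definition crowding :: "(nat \<Rightarrow> real) \<Rightarrow> real"
  where "crowding q = (\<Sum>n. real (n + 2) * q (n + 2))"

definition dispersion_rhs :: "(nat \<Rightarrow> real) \<Rightarrow> nat \<Rightarrow> real"
  where "dispersion_rhs q n =
    (if n = 0 then - crowding q * q 0
     else if n = 1 then 2 * q 2 - crowding q * (q 1 - q 0)
     else real (n + 1) * q (n + 1) - real n * q n - crowding q * (q n - q (n - 1)))"

text \<open>
  The space \<open>\<ell>\<^sup>\<infinity>\<close> is the type \<open>nat \<Rightarrow>\<^sub>C real\<close> of bounded continuous functions with the
  supremum norm (every function on the discrete space \<^typ>\<open>nat\<close> is continuous). Only times
  \<^term>\<open>t \<ge> 0\<close> matter; the derivative at \<^term>\<open>t = 0\<close> is one-sided.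
\<close>

lemma S_space_bcontfun:
  assumes "q \<in> S_space"
  shows "q \<in> bcontfun"
proof -
  have "summable q"
    using assms by (auto simp: S_space_def prob_dist_def sums_iff)
  then have "bounded (range q)"
    by (intro convergent_imp_bounded) (auto dest: summable_LIMSEQ_zero)
  then show ?thesis
    by (simp add: bcontfun_def)
qed

definition classical_solution :: "(real \<Rightarrow> nat \<Rightarrow> real) \<Rightarrow> bool"
  where "classical_solution p \<longleftrightarrow>
    (\<forall>t\<ge>0. p t \<in> S_space) \<and>
    (\<forall>t\<ge>0. ((\<lambda>s. S_norm (\<lambda>n. p s n - p t n)) \<longlongrightarrow> 0) (at t within {0..})) \<and>
    (\<exists>D :: real \<Rightarrow> (nat \<Rightarrow>\<^sub>C real).
       continuous_on {0..} D \<and>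
       (\<forall>t\<ge>0. ((\<lambda>s. Bcontfun (p s)) has_vector_derivative D t) (at t within {0..}) \<and>
               (\<forall>n. apply_bcontfun (D t) n = dispersion_rhs (p t) n)))"

definition p_star :: "real \<Rightarrow> nat \<Rightarrow> real"
  where "p_star \<mu> n = (if n = 0 then 1 - \<mu> else if n = 1 then \<mu> else 0)"

definition nu :: "real \<Rightarrow> real"
  where "nu \<mu> = \<mu> + lambert_W0 (- \<mu> * exp (- \<mu>))"

definition p_bar :: "real \<Rightarrow> nat \<Rightarrow> real"
  where "p_bar \<mu> n = (if n = 0 then 0 else nu \<mu> ^ n / fact n * (1 / (exp (nu \<mu>) - 1)))"

end

theory Submission
  imports Defs
begin

text \<open>
  Write \<open>a\<close> for the crowding and \<open>T n\<close> for the tail sum of \<open>p t\<close> from \<open>n\<close> on. In terms of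
  the tails the system reads \<open>T 1' = a * p 0\<close> and \<open>T n' = a * p (n - 1) - n * p n\<close> for
  \<open>n \<ge> 2\<close> (\<open>tail_has_derivative\<close>), and the mean \<open>\<mu>\<close> is conserved (\<open>mean_conserved\<close>), so that
  \<open>a = \<mu> - p 1\<close>.

  For \<open>\<mu> \<le> 1\<close> the distance to \<open>p_star\<close> is exactly \<open>2 * a\<close> (\<open>l1_distance_to_p_star\<close>), and the factorial
  second moment \<open>V\<close>, which dominates \<open>a\<close>, satisfies \<open>V' = 2 * \<mu> * a - 2 * V \<le> - 2 * (1 - \<mu>) * V\<close>. This
  settles \<open>\<mu> < 1\<close> (\<open>pair_moment_decay\<close>). For \<open>\<mu> = 1\<close> the functional \<open>L = V + a\<close> satisfies the Riccati
  inequality \<open>L' \<le> - c * L\<^sup>2\<close>, which gives the decay \<open>1 / t\<close> (\<open>critical_crowding_decay\<close>).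

  For \<open>\<mu> > 1\<close> let \<open>E n\<close> be the difference between the tails of \<open>p t\<close> and of \<open>p_bar \<mu>\<close>. Then
  \<open>E 1 = - p 0\<close>, equality of the means gives \<open>a - nu \<mu> = E 2 - E 1\<close>, and for \<open>n \<ge> 2\<close>
  \<open>E n' = a * (E (n - 1) - E n) - n * (E n - E (n + 1)) + (E 2 - E 1) * p_bar \<mu> (n - 1)\<close>.
  In the sum \<open>D\<close> of the \<open>\<bar>E n\<bar>\<close> over \<open>n \<ge> 2\<close> the birth terms cancel, the death terms leave a net damping
  at rate 1 plus an extra damping of \<open>\<bar>E 2\<bar>\<close>, and this extra damping absorbs the nonlinear term. The
  result is the scalar inequality \<open>D' \<le> - D + (a + 1) * p 0\<close> (\<open>sum_smoothed_gap_decay\<close>), complemented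
  by \<open>p 0' = - a * p 0\<close>.

  These two relations are bootstrapped. Since \<open>a \<ge> \<mu> - 1 > 0\<close>, the empty sites vanish
  exponentially, hence so do \<open>D\<close> and \<open>\<bar>a - nu \<mu>\<bar>\<close>. Therefore \<open>a\<close> differs from \<open>nu \<mu>\<close> by an integrable
  function and \<open>p 0\<close> decays like \<open>exp (- nu \<mu> * t)\<close> (\<open>empty_sites_sharp_decay\<close>). Feeding this back,
  \<open>D\<close> decays at the slower of the rates 1 and \<open>nu \<mu>\<close>, with an additional factor \<open>t\<close> in
  the case \<open>nu \<mu> \<ge> 1\<close>. The bounds obtained carry no factor of \<open>japanese_bracket t\<close> below the threshold, and its first
  power from the threshold on.
\<close>

section \<open>Differential inequalities with vanishing errors\<close>

lemma nonincreasing_from_nonpos_derivative: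
  fixes f :: "real \<Rightarrow> real"
  assumes "0 \<le> T"
    and f: "\<And>t. t \<in> {0..T} \<Longrightarrow> (f has_real_derivative f' t) (at t within {0..T})"
    and nonpos: "\<And>t. t \<in> {0..T} \<Longrightarrow> f' t \<le> 0"
  shows "f T \<le> f 0"
proof (rule DERIV_nonpos_imp_decreasing_open[OF \<open>0 \<le> T\<close>])
  show "continuous_on {0..T} f"
    using f by (meson DERIV_continuous continuous_on_eq_continuous_within)
  show "\<exists>y. (f has_real_derivative y) (at t) \<and> y \<le> 0" if "0 < t" "t < T" for t
    using f[of t] nonpos[of t] that by (auto simp: at_within_Icc_at)
qed

text \<open>
  Every infinite-dimensional inequality below is first proved for a truncated functional, where it
  holds up to a leakage \<open>e N\<close> through the truncation level. The leakage vanishes only pointwise in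
  time, but its integral still vanishes by dominated convergence. This is what lets weak moment
  hypotheses suffice: the tails need not be small uniformly in time.
\<close>

lemma differential_inequalities_with_vanishing_error:
  fixes F F' e :: "nat \<Rightarrow> real \<Rightarrow> real" and g g' :: "real \<Rightarrow> real"
  assumes "0 \<le> T"
    and F: "\<And>N t. t \<in> {0..T} \<Longrightarrow> (F N has_real_derivative F' N t) (at t within {0..T})"
    and g: "\<And>t. t \<in> {0..T} \<Longrightarrow> (g has_real_derivative g' t) (at t within {0..T})"
    and ineq: "\<And>N t. t \<in> {0..T} \<Longrightarrow> F' N t \<le> g' t + e N t"
    and e_cont: "\<And>N. continuous_on {0..T} (e N)"
    and e_bound: "\<And>N t. t \<in> {0..T} \<Longrightarrow> \<bar>e N t\<bar> \<le> B"
    and e_lim: "\<And>t. t \<in> {0..T} \<Longrightarrow> (\<lambda>N. e N t) \<longlonglongrightarrow> 0"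
  obtains \<eta> where "\<eta> \<longlonglongrightarrow> 0" "\<And>N. F N T \<le> F N 0 + (g T - g 0) + \<eta> N"
proof
  show "(\<lambda>N. integral {0..T} (e N)) \<longlonglongrightarrow> 0"
    using dominated_convergence(2)[of e "{0..T}" "\<lambda>_. B" "\<lambda>_. 0"]
      e_cont e_bound e_lim by (auto intro: integrable_continuous_interval)
  fix N
  let ?f = "\<lambda>t. F N t - g t - integral {0..t} (e N)"
  have "?f T \<le> ?f 0"
  proof (rule nonincreasing_from_nonpos_derivative[OF \<open>0 \<le> T\<close>])
    show "(?f has_real_derivative F' N t - g' t - e N t) (at t within {0..T})" if "t \<in> {0..T}" for t
      by (intro derivative_intros F g that integral_has_real_derivative e_cont)
    show "F' N t - g' t - e N t \<le> 0" if "t \<in> {0..T}" for t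
      using ineq[OF that, of N] by simp
  qed
  then show "F N T \<le> F N 0 + (g T - g 0) + integral {0..T} (e N)"
    by simp
qed

section \<open>Tails of a distribution\<close>

text \<open>
  Written as one minus a finite sum, a tail of \<open>p t\<close> can be differentiated in time without
  interchanging a derivative with an infinite sum. All truncated moments are built from tails.
\<close>

definition tail :: "(nat \<Rightarrow> real) \<Rightarrow> nat \<Rightarrow> real"
  where "tail q n = 1 - (\<Sum>k<n. q k)"

text \<open>
  For a distribution with finite mean this is the part of the mean carried by \<open>n \<ge> N\<close>; in this form
  it is visibly continuous along a solution.
\<close>

definition excess :: "(nat \<Rightarrow> real) \<Rightarrow> nat \<Rightarrow> real"
  where "excess q N = first_moment q - (\<Sum>n<N. real n * q n)"

lemma tail_0 [simp]: "tail q 0 = 1"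
  by (simp add: tail_def)

lemma tail_Suc: "tail q (Suc n) = tail q n - q n"
  by (simp add: tail_def)

lemma prob_dist_nonneg: "prob_dist q \<Longrightarrow> 0 \<le> q n"
  by (simp add: prob_dist_def)

lemma prob_dist_sum_le_1: "prob_dist q \<Longrightarrow> sum q {..<n} \<le> 1"
  by (auto simp: prob_dist_def sums_iff intro!: order.trans[OF sum_le_suminf[of q "{..<n}"]])

lemma tail_nonneg: "prob_dist q \<Longrightarrow> 0 \<le> tail q n"
  using prob_dist_sum_le_1[of q n] by (simp add: tail_def)

lemma tail_le_1: "prob_dist q \<Longrightarrow> tail q n \<le> 1"
  by (simp add: tail_def sum_nonneg prob_dist_nonneg)

lemma prob_dist_le_1: "prob_dist q \<Longrightarrow> q n \<le> 1"
  using tail_nonneg[of q "Suc n"] tail_le_1[of q n] by (simp add: tail_Suc)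

text \<open>
  Summation by parts: a combination of finitely many tails is a moment with the weight \<open>\<phi>\<close> frozen at
  its value \<open>\<phi> N\<close> from \<open>N\<close> on.
\<close>

lemma sum_tails_by_parts:
  fixes \<phi> :: "nat \<Rightarrow> real"
  assumes "\<phi> 0 = 0"
  shows "(\<Sum>n<N. (\<phi> (Suc n) - \<phi> n) * tail q (Suc n)) = (\<Sum>n<N. \<phi> n * q n) + \<phi> N * tail q N"
  by (induction N) (simp_all add: assms tail_Suc algebra_simps)

text \<open>
  Since \<open>\<phi>\<close> increases, freezing it at \<open>\<phi> N\<close> on \<open>n \<ge> N\<close> can only decrease the contribution of
  those \<open>n\<close>.
\<close>

lemma weighted_tail_le_remainder:
  fixes \<phi> :: "nat \<Rightarrow> real"
  assumes q: "prob_dist q" and "mono \<phi>" and sm: "summable (\<lambda>n. \<phi> n * q n)"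
  shows "\<phi> N * tail q N \<le> (\<Sum>n. \<phi> n * q n) - (\<Sum>n<N. \<phi> n * q n)"
proof -
  have sq: "summable q" "suminf q = 1"
    using q by (auto simp: prob_dist_def sums_iff)
  have "tail q N = (\<Sum>n. q (n + N))"
    using suminf_split_initial_segment[OF sq(1), of N] sq(2) by (simp add: tail_def)
  then have "\<phi> N * tail q N = (\<Sum>n. \<phi> N * q (n + N))"
    using sq by (simp add: suminf_mult summable_iff_shift)
  also have "\<dots> \<le> (\<Sum>n. \<phi> (n + N) * q (n + N))"
    using sq sm q \<open>mono \<phi>\<close>
    by (intro suminf_le mult_right_mono summable_mult)
      (auto simp: prob_dist_def mono_def summable_iff_shift[of q] summable_iff_shift[of "\<lambda>n. \<phi> n * q n"])
  also have "\<dots> = (\<Sum>n. \<phi> n * q n) - (\<Sum>n<N. \<phi> n * q n)"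
    using suminf_split_initial_segment[OF sm, of N] by simp
  finally show ?thesis .
qed

lemma weighted_tail_tendsto_0:
  fixes \<phi> :: "nat \<Rightarrow> real"
  assumes q: "prob_dist q" and "mono \<phi>" "\<And>n. 0 \<le> \<phi> n" and sm: "summable (\<lambda>n. \<phi> n * q n)"
  shows "(\<lambda>N. \<phi> N * tail q N) \<longlonglongrightarrow> 0"
proof (rule tendsto_sandwich[OF _ _ tendsto_const])
  show "(\<lambda>N. (\<Sum>n. \<phi> n * q n) - (\<Sum>n<N. \<phi> n * q n)) \<longlonglongrightarrow> 0"
    using tendsto_diff[OF tendsto_const summable_LIMSEQ[OF sm], of "\<Sum>n. \<phi> n * q n"] by simp
qed (use assms tail_nonneg[OF q] weighted_tail_le_remainder[OF q] in auto)

lemma excess_tendsto_0: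
  assumes "has_first_moment q"
  shows "excess q \<longlonglongrightarrow> 0"
  using tendsto_diff[OF tendsto_const summable_LIMSEQ, of "\<lambda>n. real n * q n" "first_moment q"] assms
  by (simp add: excess_def[abs_def] has_first_moment_def first_moment_def)

lemma excess_le:
  assumes "prob_dist q"
  shows "excess q N \<le> first_moment q"
  using assms by (simp add: excess_def sum_nonneg prob_dist_nonneg)

lemma excess_ge_tail:
  assumes "prob_dist q" "has_first_moment q"
  shows "real N * tail q N \<le> excess q N"
  using weighted_tail_le_remainder[of q real] assms
  by (simp add: excess_def has_first_moment_def first_moment_def mono_def)

lemma excess_nonneg:
  assumes "prob_dist q" "has_first_moment q"
  shows "0 \<le> excess q N"
  using excess_ge_tail[OF assms, of N] tail_nonneg[OF assms(1), of N]
  by (meson mult_nonneg_nonneg of_nat_0_le_iff order_trans)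

lemma sum_tails_eq:
  "(\<Sum>n<N. tail q (Suc n)) = first_moment q - excess q N + real N * tail q N"
  using sum_tails_by_parts[of real q N] by (simp add: excess_def)

lemma sum_tails_le_first_moment:
  assumes "prob_dist q" "has_first_moment q"
  shows "(\<Sum>n<N. tail q (Suc n)) \<le> first_moment q"
  using excess_ge_tail[OF assms, of N] by (simp add: sum_tails_eq)

lemma first_moment_nonneg: "prob_dist q \<Longrightarrow> has_first_moment q \<Longrightarrow> 0 \<le> first_moment q"
  using sum_tails_le_first_moment[of q 0] by simp

lemma crowding_eq:
  assumes "has_first_moment q"
  shows "crowding q = first_moment q - q 1"
  using suminf_split_initial_segment[of "\<lambda>n. real n * q n" 2] assms
  by (simp add: has_first_moment_def first_moment_def crowding_def eval_nat_numeral)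

lemma crowding_nonneg:
  assumes "prob_dist q" "has_first_moment q"
  shows "0 \<le> crowding q"
  using excess_nonneg[OF assms, of 2] assms by (simp add: crowding_eq excess_def eval_nat_numeral)

lemma crowding_le_first_moment:
  assumes "prob_dist q" "has_first_moment q"
  shows "crowding q \<le> first_moment q"
  using assms by (simp add: crowding_eq prob_dist_nonneg)

section \<open>Evolution of the tails\<close>

text \<open>
  The system is a discrete conservation law: its right-hand side telescopes, and the remaining flux is
  what particles leaving crowded sites take down from \<open>n + 1\<close> to \<open>n\<close>, minus what the arriving particles
  carry up.
\<close>

lemma dispersion_rhs_flux:
  "(\<Sum>k<Suc n. dispersion_rhs q k) = (if n = 0 then 0 else real (Suc n) * q (Suc n)) - crowding q * q n"
  by (induction n) (auto simp: dispersion_rhs_def algebra_simps eval_nat_numeral)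

locale dispersion_solution =
  fixes p :: "real \<Rightarrow> nat \<Rightarrow> real"
  assumes solution: "classical_solution p"
begin

lemma prob: "0 \<le> t \<Longrightarrow> prob_dist (p t)"
  using solution by (auto simp: classical_solution_def S_space_def)

lemma weighted_summable:
  assumes "0 \<le> t"
  shows "summable (\<lambda>n. (1 + real n) * \<bar>p t n\<bar>)"
  using solution assms by (auto simp: classical_solution_def S_space_def)

lemma has_mean:
  assumes "0 \<le> t"
  shows "has_first_moment (p t)"
  unfolding has_first_moment_def
  by (rule summable_comparison_test'[OF weighted_summable[OF assms]])
    (auto simp: abs_mult intro!: mult_right_mono)

lemma has_derivative_at_site:
  assumes "0 \<le> t"
  shows "((\<lambda>s. p s n) has_real_derivative dispersion_rhs (p t) n) (at t within {0..})"
proof -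
  obtain D :: "real \<Rightarrow> (nat \<Rightarrow>\<^sub>C real)"
    where D: "((\<lambda>s. Bcontfun (p s)) has_vector_derivative D t) (at t within {0..})"
      and Dn: "\<And>n. apply_bcontfun (D t) n = dispersion_rhs (p t) n"
    using solution assms by (auto simp: classical_solution_def)
  have "bounded_linear (\<lambda>f :: nat \<Rightarrow>\<^sub>C real. apply_bcontfun f n)"
    using norm_bounded[of "_ :: nat \<Rightarrow>\<^sub>C real" n] by (intro bounded_linear_intro[where K = 1]) auto
  from bounded_linear.has_vector_derivative[OF this D]
  have "((\<lambda>s. apply_bcontfun (Bcontfun (p s)) n) has_real_derivative dispersion_rhs (p t) n)
      (at t within {0..})"
    by (simp add: Dn has_real_derivative_iff_has_vector_derivative)
  moreover have "apply_bcontfun (Bcontfun (p s)) n = p s n" if "s \<in> {0..}" for s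
    using solution that
    by (subst Bcontfun_inverse) (auto simp: classical_solution_def intro: S_space_bcontfun)
  ultimately show ?thesis
    using assms by (elim has_field_derivative_transform_within[where d = 1]) auto
qed

lemma site_continuous: "continuous_on {0..} (\<lambda>t. p t n)"
  using has_derivative_at_site by (meson DERIV_continuous atLeast_iff continuous_on_eq_continuous_within)

lemma tail_continuous: "continuous_on {0..} (\<lambda>t. tail (p t) n)"
  unfolding tail_def by (intro continuous_intros site_continuous)

lemma tail_has_derivative:
  assumes "0 \<le> t"
  shows "((\<lambda>s. tail (p s) (Suc n)) has_real_derivative
    crowding (p t) * p t n - (if n = 0 then 0 else real (Suc n) * p t (Suc n))) (at t within {0..})"
proof -
  have "((\<lambda>s. tail (p s) (Suc n)) has_real_derivative 0 - (\<Sum>k<Suc n. dispersion_rhs (p t) k))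
      (at t within {0..})"
    unfolding tail_def by (intro derivative_intros has_derivative_at_site assms)
  then show ?thesis
    by (simp add: dispersion_rhs_flux del: sum.lessThan_Suc)
qed

text \<open>
  Continuity of each \<open>p t n\<close> would not exclude jumps of the mean; the weighted norm does.
\<close>

lemma mean_continuous: "continuous_on {0..} (\<lambda>t. first_moment (p t))"
proof -
  have "((\<lambda>s. first_moment (p s)) \<longlongrightarrow> first_moment (p t)) (at t within {0..})" if t: "0 \<le> t" for t
  proof (rule LIM_zero_cancel, rule Lim_null_comparison)
    show "((\<lambda>s. S_norm (\<lambda>n. p s n - p t n)) \<longlongrightarrow> 0) (at t within {0..})"
      using solution t by (simp add: classical_solution_def)
    have "norm (first_moment (p s) - first_moment (p t)) \<le> S_norm (\<lambda>n. p s n - p t n)"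
      if s: "0 \<le> s" for s
    proof -
      have sum: "summable (\<lambda>n. (1 + real n) * \<bar>p s n - p t n\<bar>)"
      proof (rule summable_comparison_test')
        show "summable (\<lambda>n. (1 + real n) * \<bar>p s n\<bar> + (1 + real n) * \<bar>p t n\<bar>)"
          using weighted_summable s t by (intro summable_add) auto
        show "norm ((1 + real n) * \<bar>p s n - p t n\<bar>) \<le> (1 + real n) * \<bar>p s n\<bar> + (1 + real n) * \<bar>p t n\<bar>" for n
          unfolding distrib_left[symmetric] by (auto simp: abs_mult intro!: mult_left_mono)
      qed
      have le: "norm (real n * (p s n - p t n)) \<le> (1 + real n) * \<bar>p s n - p t n\<bar>" for n
        by (simp add: abs_mult mult_right_mono)
      have "first_moment (p s) - first_moment (p t) = (\<Sum>n. real n * (p s n - p t n))"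
        using has_mean[OF s] has_mean[OF t]
        by (simp add: first_moment_def has_first_moment_def suminf_diff right_diff_distrib)
      also have "norm \<dots> \<le> (\<Sum>n. norm (real n * (p s n - p t n)))"
        by (intro summable_norm summable_comparison_test'[OF sum]) (use le in auto)
      also have "\<dots> \<le> S_norm (\<lambda>n. p s n - p t n)"
        unfolding S_norm_def
        by (intro suminf_le le sum summable_comparison_test'[OF sum]) (use le in auto)
      finally show ?thesis .
    qed
    then show "\<forall>\<^sub>F s in at t within {0..}. norm (first_moment (p s) - first_moment (p t)) \<le> S_norm (\<lambda>n. p s n - p t n)"
      by (auto simp: eventually_at_filter)
  qed
  then show ?thesis
    by (simp add: continuous_on_def)
qed

lemma crowding_continuous: "continuous_on {0..} (\<lambda>t. crowding (p t))"
proof (rule continuous_on_eq)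
  show "continuous_on {0..} (\<lambda>t. first_moment (p t) - p t 1)"
    by (intro continuous_intros mean_continuous site_continuous)
qed (simp add: crowding_eq has_mean)

lemma excess_continuous: "continuous_on {0..} (\<lambda>t. excess (p t) N)"
  unfolding excess_def by (intro continuous_intros mean_continuous site_continuous)

lemmas continuous_on_Icc =
  crowding_continuous[THEN continuous_on_subset] excess_continuous[THEN continuous_on_subset]
  tail_continuous[THEN continuous_on_subset] site_continuous[THEN continuous_on_subset]

text \<open>
  Truncated at a finite level, the mean changes only by what crosses that level. This leakage
  vanishes as the level grows, because the mean is finite.
\<close>

lemma truncated_mean_has_derivative:
  assumes "0 \<le> t"
  shows "((\<lambda>s. \<Sum>n<Suc N. tail (p s) (Suc n)) has_real_derivative
    excess (p t) (Suc (Suc N)) - crowding (p t) * tail (p t) (Suc N)) (at t within {0..})"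
proof -
  have "(\<Sum>n<Suc N. crowding (p t) * p t n - (if n = 0 then 0 else real (Suc n) * p t (Suc n)))
      = excess (p t) (Suc (Suc N)) - crowding (p t) * tail (p t) (Suc N)"
    by (induction N)
      (auto simp: excess_def tail_def crowding_eq has_mean[OF assms] algebra_simps)
  moreover have "((\<lambda>s. \<Sum>n<Suc N. tail (p s) (Suc n)) has_real_derivative
      (\<Sum>n<Suc N. crowding (p t) * p t n - (if n = 0 then 0 else real (Suc n) * p t (Suc n))))
      (at t within {0..})"
    by (intro DERIV_sum tail_has_derivative assms)
  ultimately show ?thesis by simp
qed

text \<open>
  Particles move between sites but are neither created nor destroyed. The leakage of the truncated mean
  has no sign, so the limiting inequality is used for the truncated mean and for its negative.
\<close>

lemma mean_conserved:
  assumes T: "0 \<le> T"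
  shows "first_moment (p T) = first_moment (p 0)"
proof -
  define F where "F = (\<lambda>N t. \<Sum>n<Suc N. tail (p t) (Suc n))"
  define e where "e = (\<lambda>N t. excess (p t) (Suc (Suc N)) - crowding (p t) * tail (p t) (Suc N))"
  have F_lim: "(\<lambda>N. F N t) \<longlonglongrightarrow> first_moment (p t)" if t: "0 \<le> t" for t
  proof -
    have "(\<lambda>N. first_moment (p t) - excess (p t) N + real N * tail (p t) N)
        \<longlonglongrightarrow> first_moment (p t) - 0 + 0"
      using weighted_tail_tendsto_0[OF prob[OF t], of real] has_mean[OF t]
      by (intro tendsto_intros excess_tendsto_0) (auto simp: mono_def has_first_moment_def)
    then have "(\<lambda>N. \<Sum>n<N. tail (p t) (Suc n)) \<longlonglongrightarrow> first_moment (p t)"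
      by (simp add: sum_tails_eq)
    from LIMSEQ_Suc[OF this] show ?thesis
      by (simp add: F_def)
  qed
  have e_cont: "continuous_on {0..T} (e N)" for N
    unfolding e_def by (intro continuous_intros continuous_on_Icc) auto
  have "bounded ((\<lambda>t. first_moment (p t)) ` {0..T})"
    by (intro compact_imp_bounded compact_continuous_image continuous_on_subset[OF mean_continuous]) auto
  then obtain B where "\<forall>t\<in>{0..T}. \<bar>first_moment (p t)\<bar> \<le> B"
    unfolding bounded_iff by auto
  then have B: "first_moment (p t) \<le> B" if "t \<in> {0..T}" for t
    using that by fastforce
  have e_bound: "\<bar>e N t\<bar> \<le> B" if "t \<in> {0..T}" for N t
  proof -
    have *: "prob_dist (p t)" "has_first_moment (p t)"
      using that by (auto intro: prob has_mean)
    have "0 \<le> crowding (p t) * tail (p t) (Suc N)"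
      by (intro mult_nonneg_nonneg crowding_nonneg tail_nonneg *)
    moreover have "crowding (p t) * tail (p t) (Suc N) \<le> crowding (p t) * 1"
      by (intro mult_left_mono crowding_nonneg tail_le_1 *)
    ultimately show ?thesis
      using excess_nonneg[OF *, of "Suc (Suc N)"] excess_le[OF *(1), of "Suc (Suc N)"]
        crowding_le_first_moment[OF *] B[OF that] by (simp add: e_def)
  qed
  have e_lim: "(\<lambda>N. e N t) \<longlonglongrightarrow> 0" if "t \<in> {0..T}" for t
  proof -
    have *: "prob_dist (p t)" "has_first_moment (p t)"
      using that by (auto intro: prob has_mean)
    have "tail (p t) \<longlonglongrightarrow> 0"
      using weighted_tail_tendsto_0[OF *(1), of "\<lambda>_. 1"] *(1)
      by (simp add: mono_def prob_dist_def sums_iff)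
    then have "(\<lambda>N. excess (p t) (Suc (Suc N)) - crowding (p t) * tail (p t) (Suc N))
        \<longlonglongrightarrow> 0 - crowding (p t) * 0"
      by (intro tendsto_intros excess_tendsto_0[OF *(2), THEN LIMSEQ_Suc, THEN LIMSEQ_Suc] LIMSEQ_Suc)
    then show ?thesis by (simp add: e_def)
  qed
  have deriv: "(F N has_real_derivative e N t) (at t within {0..T})" if "t \<in> {0..T}" for N t
    unfolding F_def e_def
    using that by (intro DERIV_subset[OF truncated_mean_has_derivative]) auto
  have "first_moment (p T) \<le> first_moment (p 0)"
  proof (rule differential_inequalities_with_vanishing_error
      [where F = F and F' = e and e = e and T = T and B = B and g = "\<lambda>_. 0" and g' = "\<lambda>_. 0"])
    fix \<eta> assume "\<eta> \<longlonglongrightarrow> 0" "\<And>N. F N T \<le> F N 0 + (0 - 0) + \<eta> N"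
    then show ?thesis
      using LIMSEQ_le[OF F_lim[OF T] tendsto_add[OF F_lim[of 0] \<open>\<eta> \<longlonglongrightarrow> 0\<close>]] by auto
  qed (use T deriv e_cont e_bound e_lim in \<open>auto intro!: derivative_eq_intros\<close>)
  moreover have "- first_moment (p T) \<le> - first_moment (p 0)"
  proof (rule differential_inequalities_with_vanishing_error
      [where F = "\<lambda>N t. - F N t" and F' = "\<lambda>N t. - e N t" and e = "\<lambda>N t. - e N t"
        and T = T and B = B and g = "\<lambda>_. 0" and g' = "\<lambda>_. 0"])
    fix \<eta> assume "\<eta> \<longlonglongrightarrow> 0" "\<And>N. - F N T \<le> - F N 0 + (0 - 0) + \<eta> N"
    then show ?thesis
      using LIMSEQ_le[OF tendsto_minus[OF F_lim[OF T]] tendsto_add[OF tendsto_minus[OF F_lim[of 0]] \<open>\<eta> \<longlonglongrightarrow> 0\<close>]] by auto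
  qed (use T deriv e_cont e_bound e_lim tendsto_minus[of "\<lambda>N. e N _" 0] in \<open>auto intro!: derivative_eq_intros continuous_intros\<close>)
  ultimately show ?thesis by simp
qed

end

section \<open>The factorial second moment\<close>

text \<open>
  The weight of the factorial moment: it vanishes at 0 and 1, so that the moment vanishes at
  \<open>p_star\<close>, and it has the increments \<open>2 * n\<close>, so that its evolution involves, besides
  itself, only the mean and the crowding.
\<close>

definition pair_weight :: "nat \<Rightarrow> real"
  where "pair_weight n = real n * (real n - 1)"

definition pair_moment :: "(nat \<Rightarrow> real) \<Rightarrow> real"
  where "pair_moment q = (\<Sum>n. pair_weight n * q n)"

definition truncated_pair_moment :: "nat \<Rightarrow> (nat \<Rightarrow> real) \<Rightarrow> real"
  where "truncated_pair_moment N q = (\<Sum>n<N. 2 * real n * tail q (Suc n))"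

lemma pair_weight_mono: "mono pair_weight"
  by (auto simp: mono_iff_le_Suc pair_weight_def algebra_simps)

lemma pair_weight_nonneg: "0 \<le> pair_weight n"
  using pair_weight_mono[THEN monoD, of 0 n] by (simp add: pair_weight_def)

lemma truncated_pair_moment_eq:
  "truncated_pair_moment N q = (\<Sum>n<N. pair_weight n * q n) + pair_weight N * tail q N"
proof -
  have "pair_weight (Suc n) - pair_weight n = 2 * real n" for n
    by (simp add: pair_weight_def algebra_simps)
  then show ?thesis
    using sum_tails_by_parts[of pair_weight q N]
    by (simp add: truncated_pair_moment_def) (simp add: pair_weight_def)
qed

lemma truncated_pair_moment_Suc:
  "truncated_pair_moment N q = (\<Sum>n<Suc N. pair_weight n * q n) + pair_weight N * tail q (Suc N)"
  by (simp add: truncated_pair_moment_eq tail_Suc algebra_simps)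

lemma truncated_pair_moment_ge:
  assumes "prob_dist q"
  shows "(\<Sum>n<N. pair_weight n * q n) \<le> truncated_pair_moment N q"
    and "pair_weight N * tail q N \<le> truncated_pair_moment N q"
  using assms
  by (simp_all add: truncated_pair_moment_eq pair_weight_nonneg tail_nonneg prob_dist_nonneg sum_nonneg)

lemma truncated_pair_moment_le:
  assumes "prob_dist q" "summable (\<lambda>n. pair_weight n * q n)"
  shows "truncated_pair_moment N q \<le> pair_moment q"
  using weighted_tail_le_remainder[OF assms(1) pair_weight_mono assms(2), of N]
  by (simp add: truncated_pair_moment_eq pair_moment_def)

lemma truncated_pair_moment_tendsto:
  assumes "prob_dist q" "summable (\<lambda>n. pair_weight n * q n)"
  shows "(\<lambda>N. truncated_pair_moment N q) \<longlonglongrightarrow> pair_moment q"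
proof -
  have "(\<lambda>N. truncated_pair_moment N q) \<longlonglongrightarrow> pair_moment q + 0"
    unfolding truncated_pair_moment_eq pair_moment_def
    by (intro tendsto_add summable_LIMSEQ assms(2)
        weighted_tail_tendsto_0[OF assms(1) pair_weight_mono pair_weight_nonneg assms(2)])
  then show ?thesis by simp
qed

lemma pair_moment_le_second_moment:
  assumes "prob_dist q" "has_second_moment q"
  shows "summable (\<lambda>n. pair_weight n * q n)" "pair_moment q \<le> second_moment q"
proof -
  have le: "pair_weight n * q n \<le> (real n)\<^sup>2 * q n" for n
    by (intro mult_right_mono prob_dist_nonneg assms) (simp add: pair_weight_def power2_eq_square mult_left_mono)
  show sum: "summable (\<lambda>n. pair_weight n * q n)"
    by (rule summable_comparison_test'[OF assms(2)[unfolded has_second_moment_def]])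
      (use le pair_weight_nonneg prob_dist_nonneg[OF assms(1)] in \<open>simp add: abs_mult\<close>)
  show "pair_moment q \<le> second_moment q"
    unfolding pair_moment_def second_moment_def
    by (intro suminf_le le sum assms(2)[unfolded has_second_moment_def])
qed

text \<open>
  Because \<open>n \<le> n * (n - 1)\<close> for \<open>n \<ge> 2\<close>, the factorial moment dominates the crowding.
\<close>

lemma crowding_le_truncated_pair_moment:
  assumes "prob_dist q" "has_first_moment q"
  shows "crowding q \<le> truncated_pair_moment N q + excess q N"
proof -
  have "(\<Sum>n<N. real n * q n) \<le> (\<Sum>n<N. pair_weight n * q n + (if n = 1 then q n else 0))"
  proof (rule sum_mono)
    fix n :: nat
    show "real n * q n \<le> pair_weight n * q n + (if n = 1 then q n else 0)"
      using prob_dist_nonneg[OF assms(1), of n] mult_right_mono[of "real n" "pair_weight n" "q n"]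
        mult_left_mono[of 1 "real n - 1" "real n"]
      by (cases "n \<le> 1") (auto simp: pair_weight_def le_Suc_eq)
  qed
  also have "\<dots> \<le> (\<Sum>n<N. pair_weight n * q n) + q 1"
    using prob_dist_nonneg[OF assms(1), of 1] by (simp add: sum.distrib sum.delta)
  also have "\<dots> \<le> truncated_pair_moment N q + q 1"
    using truncated_pair_moment_ge(1)[OF assms(1)] by simp
  finally show ?thesis
    using assms(2) by (simp add: crowding_eq excess_def)
qed

text \<open>
  In the critical case the previous bound is too weak. Here \<open>2 * n \<le> n * (n - 1)\<close> is used for \<open>n \<ge> 3\<close>,
  and the doubly occupied sites, for which it fails, are kept explicitly.
\<close>

lemma twice_crowding_le_truncated_pair_moment:
  assumes "prob_dist q" "has_first_moment q"
  shows "2 * crowding q \<le> truncated_pair_moment N q + 2 * q 2 + 2 * excess q N"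
proof -
  have "(\<Sum>n<N. 2 * (real n * q n))
      \<le> (\<Sum>n<N. pair_weight n * q n + (if n = 1 then 2 * q n else 0) + (if n = 2 then 2 * q n else 0))"
  proof (rule sum_mono)
    fix n :: nat
    have "n = 0 \<or> n = 1 \<or> n = 2 \<or> 3 \<le> n" by auto
    then show "2 * (real n * q n)
        \<le> pair_weight n * q n + (if n = 1 then 2 * q n else 0) + (if n = 2 then 2 * q n else 0)"
      using prob_dist_nonneg[OF assms(1), of n] mult_right_mono[of "2 * real n" "pair_weight n" "q n"]
        mult_left_mono[of 2 "real n - 1" "real n"]
      by (auto simp: pair_weight_def)
  qed
  also have "\<dots> \<le> (\<Sum>n<N. pair_weight n * q n) + 2 * q 1 + 2 * q 2"
    using prob_dist_nonneg[OF assms(1), of 1] prob_dist_nonneg[OF assms(1), of 2]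
    by (simp add: sum.distrib sum.delta)
  also have "\<dots> \<le> truncated_pair_moment N q + 2 * q 1 + 2 * q 2"
    using truncated_pair_moment_ge(1)[OF assms(1)] by simp
  finally show ?thesis
    using assms(2) by (simp add: crowding_eq excess_def sum_distrib_left[symmetric])
qed

lemma tail_2_le_crowding:
  assumes "prob_dist q" "has_first_moment q"
  shows "2 * tail q 2 \<le> crowding q"
  using excess_ge_tail[OF assms, of 2] assms(2) by (simp add: crowding_eq excess_def eval_nat_numeral)

text \<open>
  Relative to \<open>p_star\<close> the deficit of singly occupied sites is the crowding, and the surplus of empty and
  of crowded sites together makes up for exactly the same amount.
\<close>

lemma l1_distance_to_p_star:
  assumes q: "prob_dist q" "has_first_moment q"
  shows "l1_norm (\<lambda>n. q n - p_star (first_moment q) n) = 2 * crowding q"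
proof -
  have sq: "summable q" "suminf q = 1"
    using q by (auto simp: prob_dist_def sums_iff)
  define d where "d = (\<lambda>n. \<bar>q n - p_star (first_moment q) n\<bar>)"
  have shift: "d (n + 2) = q (n + 2)" for n
    using prob_dist_nonneg[OF q(1)] by (simp add: d_def p_star_def)
  have "summable (\<lambda>n. d (n + 2))"
    unfolding shift using sq by (subst summable_iff_shift)
  then have "summable d"
    by (subst (asm) summable_iff_shift)
  then have "suminf d = (\<Sum>n. d (n + 2)) + d 0 + d 1"
    using suminf_split_initial_segment[of d 2] by (simp add: eval_nat_numeral)
  also have "(\<Sum>n. d (n + 2)) = tail q 2"
    unfolding shift using suminf_split_initial_segment[OF sq(1), of 2] sq(2) by (simp add: tail_def)
  also have "d 0 = crowding q - tail q 2"
    using tail_2_le_crowding[OF q] tail_nonneg[OF q(1), of 2]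
    by (simp add: d_def p_star_def crowding_eq[OF q(2)] tail_def eval_nat_numeral)
  also have "d 1 = crowding q"
    using crowding_nonneg[OF q] by (simp add: d_def p_star_def crowding_eq[OF q(2)])
  finally show ?thesis
    by (simp add: l1_norm_def d_def)
qed

section \<open>Decay up to the critical mean\<close>

context dispersion_solution
begin

abbreviation \<mu> :: real where "\<mu> \<equiv> first_moment (p 0)"

lemma crowding_range:
  assumes "0 \<le> t"
  shows "0 \<le> crowding (p t)" "crowding (p t) \<le> \<mu>"
  using crowding_nonneg[OF prob has_mean, OF assms assms]
    crowding_le_first_moment[OF prob has_mean, OF assms assms] mean_conserved[OF assms] by auto

lemma truncated_pair_moment_has_derivative:
  assumes "0 \<le> t"
  shows "((\<lambda>s. truncated_pair_moment N (p s)) has_real_derivative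
    2 * crowding (p t) * (\<mu> - excess (p t) N)
      - 2 * (truncated_pair_moment N (p t) - pair_weight N * tail (p t) (Suc N))) (at t within {0..})"
proof -
  have "(\<Sum>n<N. 2 * real n * (crowding (p t) * p t n - (if n = 0 then 0 else real (Suc n) * p t (Suc n))))
      = 2 * crowding (p t) * (\<mu> - excess (p t) N)
        - 2 * (truncated_pair_moment N (p t) - pair_weight N * tail (p t) (Suc N))"
    unfolding truncated_pair_moment_Suc
    by (induction N)
      (simp_all add: excess_def mean_conserved[OF assms] pair_weight_def algebra_simps)
  moreover have "((\<lambda>s. truncated_pair_moment N (p s)) has_real_derivative
      (\<Sum>n<N. 2 * real n * (crowding (p t) * p t n - (if n = 0 then 0 else real (Suc n) * p t (Suc n)))))
      (at t within {0..})"
    unfolding truncated_pair_moment_def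
    by (intro DERIV_sum DERIV_cmult tail_has_derivative assms)
  ultimately show ?thesis by simp
qed

text \<open>
  This crude bound propagates the finiteness of the second moment, which is not part of the notion of
  solution, and at the same time dominates the leakage terms on bounded time intervals.
\<close>

lemma truncated_pair_moment_grows_linearly:
  assumes sum: "summable (\<lambda>n. pair_weight n * p 0 n)" and T: "0 \<le> T"
  shows "truncated_pair_moment N (p T) \<le> pair_moment (p 0) + 2 * \<mu>\<^sup>2 * T"
proof -
  have mu: "0 \<le> \<mu>" by (simp add: first_moment_nonneg prob has_mean)
  have "truncated_pair_moment N (p T) - 2 * \<mu>\<^sup>2 * T \<le> truncated_pair_moment N (p 0) - 2 * \<mu>\<^sup>2 * 0"
  proof (rule nonincreasing_from_nonpos_derivative[OF T])
    fix t assume "t \<in> {0..T}"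
    then have t: "0 \<le> t" by simp
    show "((\<lambda>t. truncated_pair_moment N (p t) - 2 * \<mu>\<^sup>2 * t) has_real_derivative
        2 * crowding (p t) * (\<mu> - excess (p t) N)
      - 2 * (truncated_pair_moment N (p t) - pair_weight N * tail (p t) (Suc N)) - 2 * \<mu>\<^sup>2 * 1)
        (at t within {0..T})"
      by (intro DERIV_diff DERIV_cmult DERIV_ident
          DERIV_subset[OF truncated_pair_moment_has_derivative[OF t]]) auto
    have "0 \<le> truncated_pair_moment N (p t) - pair_weight N * tail (p t) (Suc N)"
      unfolding truncated_pair_moment_Suc
      using prob_dist_nonneg[OF prob[OF t]] by (simp add: sum_nonneg pair_weight_nonneg)
    moreover have "crowding (p t) * (\<mu> - excess (p t) N) \<le> \<mu> * \<mu>"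
      using crowding_range[OF t] excess_le[OF prob[OF t], of N] excess_nonneg[OF prob[OF t] has_mean[OF t], of N] mean_conserved[OF t]
      by (intro mult_mono) auto
    ultimately show "2 * crowding (p t) * (\<mu> - excess (p t) N)
      - 2 * (truncated_pair_moment N (p t) - pair_weight N * tail (p t) (Suc N)) - 2 * \<mu>\<^sup>2 * 1 \<le> 0"
      by (simp add: power2_eq_square)
  qed
  also have "truncated_pair_moment N (p 0) \<le> pair_moment (p 0)"
    by (intro truncated_pair_moment_le prob sum) simp
  finally show ?thesis by simp
qed

lemma pair_weight_summable:
  assumes sum: "summable (\<lambda>n. pair_weight n * p 0 n)" and t: "0 \<le> t"
  shows "summable (\<lambda>n. pair_weight n * p t n)"
proof (rule summableI_nonneg_bounded)
  show "0 \<le> pair_weight n * p t n" for n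
    by (simp add: pair_weight_nonneg prob_dist_nonneg prob t)
  show "(\<Sum>i<n. pair_weight i * p t i) \<le> pair_moment (p 0) + 2 * \<mu>\<^sup>2 * t" for n
    using truncated_pair_moment_ge(1)[OF prob[OF t], of n]
      truncated_pair_moment_grows_linearly[OF sum t, of n]
    by linarith
qed

lemma pair_tail_continuous: "continuous_on {0..} (\<lambda>t. pair_weight N * tail (p t) N)"
  by (intro continuous_intros tail_continuous)

lemma pair_tail_le:
  assumes "summable (\<lambda>n. pair_weight n * p 0 n)" "t \<in> {0..T}"
  shows "pair_weight N * tail (p t) N \<le> pair_moment (p 0) + 2 * \<mu>\<^sup>2 * T"
proof -
  have t: "0 \<le> t" "t \<le> T" using assms by auto
  have "2 * \<mu>\<^sup>2 * t \<le> 2 * \<mu>\<^sup>2 * T"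
    using t by (intro mult_left_mono) auto
  then show ?thesis
    using truncated_pair_moment_ge(2)[OF prob[OF t(1)], of N]
      truncated_pair_moment_grows_linearly[OF assms(1) t(1), of N] by simp
qed

lemma pair_tail_tendsto_0:
  assumes "summable (\<lambda>n. pair_weight n * p 0 n)" "0 \<le> t"
  shows "(\<lambda>N. pair_weight N * tail (p t) N) \<longlonglongrightarrow> 0"
  by (rule weighted_tail_tendsto_0[OF prob[OF assms(2)] pair_weight_mono pair_weight_nonneg
        pair_weight_summable[OF assms]])

lemma pair_tail_nonneg: "0 \<le> t \<Longrightarrow> 0 \<le> pair_weight N * tail (p t) N"
  by (simp add: pair_weight_nonneg tail_nonneg prob)

lemma pair_tail_Suc_le:
  "0 \<le> t \<Longrightarrow> pair_weight N * tail (p t) (Suc N) \<le> pair_weight N * tail (p t) N"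
  by (intro mult_left_mono pair_weight_nonneg) (simp add: tail_Suc prob_dist_nonneg prob)

lemma excess_range:
  assumes "0 \<le> t"
  shows "0 \<le> excess (p t) N" "excess (p t) N \<le> \<mu>"
  using excess_nonneg[OF prob has_mean, OF assms assms] excess_le[OF prob, OF assms, of N]
    mean_conserved[OF assms] by auto

text \<open>
  Formally the factorial moment \<open>V\<close> satisfies \<open>V' = 2 * \<mu> * a - 2 * V\<close>, where \<open>a\<close> is the crowding, and
  \<open>a \<le> V\<close>.
\<close>

lemma pair_moment_decay:
  assumes sum: "summable (\<lambda>n. pair_weight n * p 0 n)" and T: "0 \<le> T" and "\<mu> \<le> 1"
  shows "pair_moment (p T) \<le> exp (- 2 * (1 - \<mu>) * T) * pair_moment (p 0)"
proof -
  define \<kappa> where "\<kappa> = 2 * (1 - \<mu>)"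
  have kap: "0 \<le> \<kappa>" using \<open>\<mu> \<le> 1\<close> by (simp add: \<kappa>_def)
  have mu: "0 \<le> \<mu>" by (simp add: first_moment_nonneg prob has_mean)
  define V where "V = (\<lambda>N t. truncated_pair_moment N (p t))"
  define F where "F = (\<lambda>N t. exp (\<kappa> * t) * V N t)"
  define V' where "V' = (\<lambda>N t. 2 * crowding (p t) * (\<mu> - excess (p t) N)
    - 2 * (V N t - pair_weight N * tail (p t) (Suc N)))"
  define e where "e = (\<lambda>N t. exp (\<kappa> * t) * (2 * \<mu> * excess (p t) N + 2 * (pair_weight N * tail (p t) N)))"
  obtain \<eta> where eta: "\<eta> \<longlonglongrightarrow> 0" "\<And>N. F N T \<le> F N 0 + (0 - 0) + \<eta> N"
  proof (rule differential_inequalities_with_vanishing_error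
      [where F = F and F' = "\<lambda>N t. \<kappa> * exp (\<kappa> * t) * V N t + V' N t * exp (\<kappa> * t)" and e = e and T = T
        and B = "exp (\<kappa> * T) * (2 * \<mu> * \<mu> + 2 * (pair_moment (p 0) + 2 * \<mu>\<^sup>2 * T))"
        and g = "\<lambda>_. 0" and g' = "\<lambda>_. 0"])
    fix N t assume tT: "t \<in> {0..T}"
    then have t: "0 \<le> t" by simp
    have dV: "(V N has_real_derivative V' N t) (at t within {0..T})"
      unfolding V_def V'_def
      by (intro DERIV_subset[OF truncated_pair_moment_has_derivative[OF t]]) auto
    show "(F N has_real_derivative \<kappa> * exp (\<kappa> * t) * V N t + V' N t * exp (\<kappa> * t)) (at t within {0..T})"
      unfolding F_def by (rule derivative_eq_intros dV refl)+ simp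
    have "V' N t \<le> 2 * \<mu> * crowding (p t) - 2 * V N t + 2 * (pair_weight N * tail (p t) N)"
      using pair_tail_Suc_le[OF t, of N]
        mult_nonneg_nonneg[OF crowding_range(1)[OF t] excess_range(1)[OF t, of N]]
      by (simp add: V'_def algebra_simps)
    also have "2 * \<mu> * crowding (p t) \<le> 2 * \<mu> * (V N t + excess (p t) N)"
      using crowding_le_truncated_pair_moment[OF prob[OF t] has_mean[OF t], of N] mu
      by (intro mult_left_mono) (auto simp: V_def)
    finally have "\<kappa> * V N t + V' N t \<le> 2 * \<mu> * excess (p t) N + 2 * (pair_weight N * tail (p t) N)"
      by (simp add: \<kappa>_def algebra_simps)
    from mult_left_mono[OF this, of "exp (\<kappa> * t)"]
    show "\<kappa> * exp (\<kappa> * t) * V N t + V' N t * exp (\<kappa> * t) \<le> 0 + e N t"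
      by (simp add: e_def algebra_simps)
    have "\<bar>e N t\<bar> = e N t"
      using excess_range[OF t, of N] pair_tail_nonneg[OF t, of N] mu by (simp add: e_def)
    also have "\<dots> \<le> exp (\<kappa> * T) * (2 * \<mu> * \<mu> + 2 * (pair_moment (p 0) + 2 * \<mu>\<^sup>2 * T))"
      unfolding e_def
      using tT kap mu excess_range[OF t, of N] pair_tail_nonneg[OF t, of N] pair_tail_le[OF sum tT, of N]
        mult_left_mono[of t T \<kappa>]
      by (intro mult_mono add_mono order_refl) auto
    finally show "\<bar>e N t\<bar> \<le> exp (\<kappa> * T) * (2 * \<mu> * \<mu> + 2 * (pair_moment (p 0) + 2 * \<mu>\<^sup>2 * T))" .
  next
    show "continuous_on {0..T} (e N)" for N
      unfolding e_def
      by (intro continuous_intros continuous_on_Icc pair_tail_continuous[THEN continuous_on_subset]) auto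
  next
    fix t assume "t \<in> {0..T}"
    then have t: "0 \<le> t" by simp
    have "(\<lambda>N. exp (\<kappa> * t) * (2 * \<mu> * excess (p t) N + 2 * (pair_weight N * tail (p t) N)))
      \<longlonglongrightarrow> exp (\<kappa> * t) * (2 * \<mu> * 0 + 2 * 0)"
      by (intro tendsto_intros excess_tendsto_0 has_mean pair_tail_tendsto_0 t sum)
    then show "(\<lambda>N. e N t) \<longlonglongrightarrow> 0" by (simp add: e_def)
  qed (use T in auto)
  have lim: "(\<lambda>N. V N t) \<longlonglongrightarrow> pair_moment (p t)" if "0 \<le> t" for t
    unfolding V_def by (intro truncated_pair_moment_tendsto prob pair_weight_summable[OF sum] that)
  have "exp (\<kappa> * T) * pair_moment (p T) \<le> exp (\<kappa> * 0) * pair_moment (p 0) + (0 - 0) + 0"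
  proof (rule LIMSEQ_le)
    show "(\<lambda>N. F N T) \<longlonglongrightarrow> exp (\<kappa> * T) * pair_moment (p T)"
      unfolding F_def by (intro tendsto_intros lim T)
    show "(\<lambda>N. F N 0 + (0 - 0) + \<eta> N) \<longlonglongrightarrow> exp (\<kappa> * 0) * pair_moment (p 0) + (0 - 0) + 0"
      unfolding F_def by (intro tendsto_intros lim eta) simp
  qed (use eta in auto)
  then have le: "exp (\<kappa> * T) * pair_moment (p T) \<le> pair_moment (p 0)"
    by simp
  have "pair_moment (p T) = exp (- \<kappa> * T) * (exp (\<kappa> * T) * pair_moment (p T))"
    by (simp add: exp_minus)
  also have "\<dots> \<le> exp (- \<kappa> * T) * pair_moment (p 0)"
    using le by (intro mult_left_mono) auto
  also have "- \<kappa> * T = - 2 * (1 - \<mu>) * T"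
    by (simp add: \<kappa>_def)
  finally show ?thesis .
qed

lemma crowding_le_pair_moment:
  assumes sum: "summable (\<lambda>n. pair_weight n * p 0 n)" and t: "0 \<le> t"
  shows "crowding (p t) \<le> pair_moment (p t)"
proof (rule LIMSEQ_le_const)
  have "(\<lambda>N. truncated_pair_moment N (p t) + excess (p t) N) \<longlonglongrightarrow> pair_moment (p t) + 0"
    by (intro tendsto_intros truncated_pair_moment_tendsto prob pair_weight_summable[OF sum] t
        excess_tendsto_0 has_mean)
  then show "(\<lambda>N. truncated_pair_moment N (p t) + excess (p t) N) \<longlonglongrightarrow> pair_moment (p t)"
    by simp
qed (use crowding_le_truncated_pair_moment[OF prob[OF t] has_mean[OF t]] in auto)

text \<open>
  For \<open>\<mu> = 1\<close> the equation \<open>V' = - 2 * (V - a)\<close> gives no decay while all crowded sites hold exactly two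
  particles, since then \<open>V = a\<close>. Adding \<open>a\<close> itself repairs this: \<open>L = V + a\<close> satisfies
  \<open>L' \<le> - W - 3 / 2 * a\<^sup>2\<close> with \<open>W = V - a\<close>. As \<open>W\<close> is at most the initial moment, the right-hand
  side is, with \<open>M = 1 + pair_moment (p 0)\<close>, at most \<open>- L\<^sup>2 / (8 * M)\<close>, and so \<open>L \<le> 8 * M / t\<close>.
\<close>

lemma critical_crowding_decay:
  assumes sum: "summable (\<lambda>n. pair_weight n * p 0 n)" and T: "0 < T" and mu: "\<mu> = 1"
  shows "2 * crowding (p T) \<le> 8 * (1 + pair_moment (p 0)) / T"
proof -
  define M where "M = 1 + pair_moment (p 0)"
  have M: "1 \<le> M"
    using crowding_range(1)[of 0] crowding_le_pair_moment[OF sum, of 0] by (simp add: M_def)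
  define V where "V = (\<lambda>N t. truncated_pair_moment N (p t))"
  define V' where "V' = (\<lambda>N t. 2 * crowding (p t) * (\<mu> - excess (p t) N)
    - 2 * (V N t - pair_weight N * tail (p t) (Suc N)))"
  define a where "a = (\<lambda>t. \<mu> - p t 1)"
  \<comment> \<open>The factor \<open>t\<^sup>2\<close> linearises the Riccati inequality \<open>L' \<le> - c * L\<^sup>2\<close>: completing the square,
    \<open>(t\<^sup>2 * L)' \<le> 2 * t * L - c * t\<^sup>2 * L\<^sup>2 \<le> 1 / c\<close>. The estimate is now linear in \<open>L\<close> and tolerates an
    additive error.\<close>
  define F where "F = (\<lambda>N t. t\<^sup>2 * (V N t + a t))"
  define F' where "F' = (\<lambda>N t. 2 * t * (V N t + a t) + t\<^sup>2 * (V' N t - dispersion_rhs (p t) 1))"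
  define e where "e = (\<lambda>N t. t\<^sup>2 * (4 * excess (p t) N + 2 * (pair_weight N * tail (p t) N)))"
  have a_eq: "a t = crowding (p t)" if "0 \<le> t" for t
    by (simp add: a_def crowding_eq[OF has_mean[OF that]] mean_conserved[OF that])
  obtain \<eta> where eta: "\<eta> \<longlonglongrightarrow> 0" "\<And>N. F N T \<le> F N 0 + (8 * M * T - 8 * M * 0) + \<eta> N"
  proof (rule differential_inequalities_with_vanishing_error
      [where F = F and F' = F' and e = e and T = T
        and B = "T\<^sup>2 * (4 * 1 + 2 * (pair_moment (p 0) + 2 * \<mu>\<^sup>2 * T))"
        and g = "\<lambda>t. 8 * M * t" and g' = "\<lambda>_. 8 * M"])
    fix N t assume tT: "t \<in> {0..T}"
    then have t: "0 \<le> t" by simp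
    note q = prob[OF t] has_mean[OF t]
    have dV: "(V N has_real_derivative V' N t) (at t within {0..T})"
      unfolding V_def V'_def
      by (intro DERIV_subset[OF truncated_pair_moment_has_derivative[OF t]]) auto
    have dp: "((\<lambda>s. p s 1) has_real_derivative dispersion_rhs (p t) 1) (at t within {0..T})"
      by (intro DERIV_subset[OF has_derivative_at_site[OF t]]) auto
    show "(F N has_real_derivative F' N t) (at t within {0..T})"
      unfolding F_def F'_def a_def
      by (rule derivative_eq_intros dV dp refl)+ (simp add: a_def algebra_simps)
    define x where "x = excess (p t) N"
    define y where "y = pair_weight N * tail (p t) N"
    define W where "W = V N t - a t"
    have x: "0 \<le> x" "x \<le> 1" using excess_range[OF t, of N] mu by (auto simp: x_def)
    have y: "0 \<le> y" using pair_tail_nonneg[OF t] by (simp add: y_def)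
    have a: "0 \<le> a t" "a t \<le> 1" using crowding_range[OF t] mu by (auto simp: a_eq[OF t])
    have "V' N t \<le> 2 * a t - 2 * V N t + 2 * y"
      using pair_tail_Suc_le[OF t, of N] mult_nonneg_nonneg[OF a(1) x(1)] mu
      by (simp add: V'_def algebra_simps y_def a_eq[OF t] flip: x_def)
    moreover have "- dispersion_rhs (p t) 1 \<le> a t - 3 / 2 * (a t)\<^sup>2 - 2 * p t 2"
    proof -
      have "p t 1 - p t 0 = 1 - 2 * a t + tail (p t) 2"
        using mu by (simp add: a_def tail_def eval_nat_numeral)
      also have "\<dots> \<le> 1 - 3 / 2 * a t"
        using tail_2_le_crowding[OF q] a_eq[OF t] by simp
      finally have "a t * (p t 1 - p t 0) \<le> a t * (1 - 3 / 2 * a t)"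
        using a by (intro mult_left_mono)
      then show ?thesis
        by (simp add: dispersion_rhs_def a_eq[OF t] power2_eq_square algebra_simps)
    qed
    moreover have "2 * a t \<le> V N t + 2 * p t 2 + 2 * x"
      using twice_crowding_le_truncated_pair_moment[OF q, of N] by (simp add: a_eq[OF t] V_def x_def)
    ultimately have L': "V' N t - dispersion_rhs (p t) 1 \<le> - W - 3 / 2 * (a t)\<^sup>2 + 2 * x + 2 * y"
      by (simp add: W_def)
    have W_ge: "- x \<le> W"
      using crowding_le_truncated_pair_moment[OF q, of N] by (simp add: W_def V_def x_def a_eq[OF t])
    have W_le: "W \<le> M"
    proof -
      have "V N t \<le> pair_moment (p t)"
        unfolding V_def by (intro truncated_pair_moment_le prob pair_weight_summable[OF sum] t)
      also have "\<dots> \<le> pair_moment (p 0)"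
        using pair_moment_decay[OF sum t] mu by simp
      finally show ?thesis using a by (simp add: W_def M_def)
    qed
    \<comment> \<open>Truncation may make \<open>W\<close> slightly negative; its square is then absorbed by the leakage \<open>x\<close>.\<close>
    have W2: "- W \<le> - (W\<^sup>2 / M) + 2 * x"
    proof (cases "0 \<le> W")
      case True
      then have "W * W \<le> W * M" using W_le by (intro mult_left_mono)
      then have "W\<^sup>2 / M \<le> W" using M by (simp add: power2_eq_square field_simps)
      then show ?thesis using x by simp
    next
      case False
      have "W\<^sup>2 = (- W) * (- W)" by (simp add: power2_eq_square)
      also have "\<dots> \<le> x * 1" using False W_ge x by (intro mult_mono) auto
      finally have "W\<^sup>2 / M \<le> x / 1" using M x by (intro frac_le) auto
      then show ?thesis using W_ge by simp
    qed
    define L where "L = V N t + a t"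
    have "L\<^sup>2 / (8 * M) \<le> W\<^sup>2 / M + 3 / 2 * (a t)\<^sup>2"
    proof -
      have "L\<^sup>2 \<le> 8 * W\<^sup>2 + 8 * (a t)\<^sup>2"
        using sum_squares_ge_zero[of "W - 2 * a t" W] zero_le_power2[of "W - 2 * a t"] zero_le_power2[of W]
        by (simp add: L_def W_def power2_eq_square algebra_simps)
      also have "\<dots> \<le> 8 * W\<^sup>2 + M * (12 * (a t)\<^sup>2)"
        using mult_right_mono[OF M, of "12 * (a t)\<^sup>2"] zero_le_power2[of "a t"] by linarith
      finally show ?thesis using M by (simp add: field_simps)
    qed
    with L' W2 have "V' N t - dispersion_rhs (p t) 1 \<le> - (L\<^sup>2 / (8 * M)) + 4 * x + 2 * y"
      by simp
    then have "F' N t \<le> 2 * t * L + t\<^sup>2 * (- (L\<^sup>2 / (8 * M)) + 4 * x + 2 * y)"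
      unfolding F'_def L_def by (intro add_left_mono mult_left_mono) auto
    moreover have "2 * t * L - t\<^sup>2 * (L\<^sup>2 / (8 * M)) \<le> 8 * M"
    proof -
      have "0 \<le> (t * L - 8 * M)\<^sup>2 / (8 * M)" using M by simp
      also have "\<dots> = t\<^sup>2 * (L\<^sup>2 / (8 * M)) - 2 * t * L + 8 * M"
        using M by (simp add: power2_eq_square field_simps)
      finally show ?thesis by simp
    qed
    ultimately show "F' N t \<le> 8 * M + e N t"
      by (simp add: e_def x_def y_def algebra_simps)
    have "\<bar>e N t\<bar> = e N t"
      using x y by (simp add: e_def x_def y_def)
    also have "\<dots> \<le> T\<^sup>2 * (4 * 1 + 2 * (pair_moment (p 0) + 2 * \<mu>\<^sup>2 * T))"
      unfolding e_def
      using tT x y pair_tail_le[OF sum tT, of N]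
      by (intro mult_mono add_mono power_mono) (auto simp: x_def y_def)
    finally show "\<bar>e N t\<bar> \<le> T\<^sup>2 * (4 * 1 + 2 * (pair_moment (p 0) + 2 * \<mu>\<^sup>2 * T))" .
  next
    show "continuous_on {0..T} (e N)" for N
      unfolding e_def
      by (intro continuous_intros continuous_on_Icc pair_tail_continuous[THEN continuous_on_subset]) auto
  next
    fix t assume "t \<in> {0..T}"
    then have t: "0 \<le> t" by simp
    have "(\<lambda>N. t\<^sup>2 * (4 * excess (p t) N + 2 * (pair_weight N * tail (p t) N)))
      \<longlonglongrightarrow> t\<^sup>2 * (4 * 0 + 2 * 0)"
      by (intro tendsto_intros excess_tendsto_0 has_mean pair_tail_tendsto_0 t sum)
    then show "(\<lambda>N. e N t) \<longlonglongrightarrow> 0" by (simp add: e_def)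
  next
    show "((\<lambda>t. 8 * M * t) has_real_derivative 8 * M) (at t within {0..T})" for t
      by (rule derivative_eq_intros refl)+ simp
  qed (use T in auto)
  have T0: "0 \<le> T" using T by simp
  have "(\<lambda>N. F N T) \<longlonglongrightarrow> T\<^sup>2 * (pair_moment (p T) + a T)"
    unfolding F_def V_def
    by (intro tendsto_intros truncated_pair_moment_tendsto prob pair_weight_summable[OF sum] T0)
  moreover have "(\<lambda>N. 8 * M * T + \<eta> N) \<longlonglongrightarrow> 8 * M * T + 0"
    by (intro tendsto_intros eta)
  ultimately have "T\<^sup>2 * (pair_moment (p T) + a T) \<le> 8 * M * T + 0"
    by (rule LIMSEQ_le) (use eta(2) in \<open>auto simp: F_def\<close>)
  moreover have "T\<^sup>2 * (2 * a T) \<le> T\<^sup>2 * (pair_moment (p T) + a T)"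
    using crowding_le_pair_moment[OF sum T0] by (intro mult_left_mono) (auto simp: a_eq[OF T0])
  ultimately have "T\<^sup>2 * (2 * a T) \<le> 8 * M * T"
    by linarith
  then have "(T * (2 * a T)) * T \<le> (8 * M) * T"
    by (simp add: power2_eq_square mult_ac)
  then have "T * (2 * a T) \<le> 8 * M"
    using T by (rule mult_right_le_imp_le)
  then show ?thesis
    using T by (simp add: a_eq[OF T0] M_def field_simps)
qed

end

section \<open>The supercritical equilibrium\<close>

lemma mult_exp_strict_mono:
  fixes x y :: real
  assumes "- 1 \<le> x" "x < y"
  shows "x * exp x < y * exp y"
proof (rule DERIV_pos_imp_increasing_open[OF \<open>x < y\<close>])
  fix z assume "x < z" "z < y"
  have "((\<lambda>z. z * exp z) has_real_derivative (1 + z) * exp z) (at z)"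
    by (rule derivative_eq_intros refl)+ (simp add: algebra_simps)
  moreover have "0 < (1 + z) * exp z"
    using \<open>x < z\<close> assms by simp
  ultimately show "\<exists>d. ((\<lambda>z. z * exp z) has_real_derivative d) (at z) \<and> 0 < d"
    by blast
qed (intro continuous_intros)

text \<open>
  On [-1, 0] the function \<open>y * exp y\<close> rises from \<open>- exp (- 1)\<close> to 0, and the value
  \<open>- \<mu> * exp (- \<mu>)\<close> lies between because \<open>\<mu> \<le> exp (\<mu> - 1)\<close>.
\<close>

lemma lambert_W0_correct:
  assumes "1 < \<mu>"
  shows "- 1 \<le> lambert_W0 (- \<mu> * exp (- \<mu>))"
    and "lambert_W0 (- \<mu> * exp (- \<mu>)) * exp (lambert_W0 (- \<mu> * exp (- \<mu>))) = - \<mu> * exp (- \<mu>)"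
proof -
  have "\<mu> * exp (- \<mu>) \<le> exp (\<mu> - 1) * exp (- \<mu>)"
    using exp_ge_add_one_self[of "\<mu> - 1"] by (intro mult_right_mono) auto
  then have "\<exists>y\<ge>- 1. y \<le> 0 \<and> y * exp y = - \<mu> * exp (- \<mu>)"
    using assms by (intro IVT'[of "\<lambda>y. y * exp y"]) (auto intro!: continuous_intros simp flip: exp_add)
  then obtain y where y: "- 1 \<le> y" "y * exp y = - \<mu> * exp (- \<mu>)"
    by blast
  have "- 1 \<le> lambert_W0 (- \<mu> * exp (- \<mu>)) \<and>
      lambert_W0 (- \<mu> * exp (- \<mu>)) * exp (lambert_W0 (- \<mu> * exp (- \<mu>))) = - \<mu> * exp (- \<mu>)"
    unfolding lambert_W0_def
  proof (rule theI)
    show "z = y" if "- 1 \<le> z \<and> z * exp z = - \<mu> * exp (- \<mu>)" for z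
      using that y mult_exp_strict_mono[of z y] mult_exp_strict_mono[of y z] by (cases z y rule: linorder_cases) auto
  qed (use y in auto)
  then show "- 1 \<le> lambert_W0 (- \<mu> * exp (- \<mu>))"
    and "lambert_W0 (- \<mu> * exp (- \<mu>)) * exp (lambert_W0 (- \<mu> * exp (- \<mu>))) = - \<mu> * exp (- \<mu>)"
    by auto
qed

lemma nu_ge: "1 < \<mu> \<Longrightarrow> \<mu> - 1 \<le> nu \<mu>"
  using lambert_W0_correct(1)[of \<mu>] by (simp add: nu_def)

lemma nu_equation:
  assumes "1 < \<mu>"
  shows "(\<mu> - nu \<mu>) * (exp (nu \<mu>) - 1) = nu \<mu>"
proof -
  have "(nu \<mu> - \<mu>) * exp (nu \<mu> - \<mu>) = - \<mu> * exp (- \<mu>)"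
    using lambert_W0_correct(2)[OF assms] by (simp add: nu_def)
  moreover have "exp (nu \<mu> - \<mu>) = exp (nu \<mu>) * exp (- \<mu>)"
    by (simp flip: exp_add)
  ultimately have "((nu \<mu> - \<mu>) * exp (nu \<mu>)) * exp (- \<mu>) = (- \<mu>) * exp (- \<mu>)"
    by simp
  then have "(nu \<mu> - \<mu>) * exp (nu \<mu>) = - \<mu>"
    by (simp only: mult_cancel_right exp_not_eq_zero simp_thms)
  then show ?thesis by (simp add: algebra_simps)
qed

text \<open>
  The threshold is where \<open>lambert_W0 (- \<mu> * exp (- \<mu>)) = 1 - \<mu>\<close>. Both sides are compared by applying
  the increasing function \<open>y * exp y\<close>, which is possible as long as \<open>1 - \<mu> \<ge> - 1\<close>; for larger \<open>\<mu>\<close>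
  already \<open>\<mu> - 1 \<le> nu \<mu>\<close> decides.
\<close>

lemma nu_less_1_iff:
  assumes "1 < \<mu>"
  shows "nu \<mu> < 1 \<longleftrightarrow> \<mu> < exp 1 / (exp 1 - 1)"
proof -
  define y where "y = lambert_W0 (- \<mu> * exp (- \<mu>))"
  have y: "- 1 \<le> y" "y * exp y = - \<mu> * exp (- \<mu>)"
    using lambert_W0_correct[OF assms] by (auto simp: y_def)
  have e: "(2 :: real) < exp 1" using exp_lower_Taylor_quadratic[of "1 :: real"] by simp
  have mid: "(1 - \<mu>) * exp (1 - \<mu>) = (1 - \<mu>) * exp 1 * exp (- \<mu>)"
    by (simp flip: exp_add add: mult.assoc)
  show ?thesis
  proof (cases "\<mu> \<le> 2")
    case True
    have "nu \<mu> < 1 \<longleftrightarrow> y < 1 - \<mu>"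
      by (auto simp: nu_def y_def)
    also have "\<dots> \<longleftrightarrow> y * exp y < (1 - \<mu>) * exp (1 - \<mu>)"
      using mult_exp_strict_mono[of y "1 - \<mu>"] mult_exp_strict_mono[of "1 - \<mu>" y] y(1) True
      by (cases y "1 - \<mu>" rule: linorder_cases) auto
    also have "\<dots> \<longleftrightarrow> - \<mu> < (1 - \<mu>) * exp 1"
      unfolding y(2) mid by (rule mult_less_cancel_right_pos) simp
    also have "\<dots> \<longleftrightarrow> \<mu> < exp 1 / (exp 1 - 1)"
      using e by (simp add: field_simps)
    finally show ?thesis .
  next
    case False
    then have "\<not> \<mu> < exp 1 / (exp 1 - 1)"
    proof -
      have "exp 1 / (exp 1 - 1) < (2 :: real)" using e by (simp add: field_simps)
      then show ?thesis using False by simp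
    qed
    then show ?thesis using nu_ge[OF assms] False by simp
  qed
qed

lemma p_bar_0: "p_bar \<mu> 0 = 0"
  by (simp add: p_bar_def)

lemma p_bar_Suc: "p_bar \<mu> (Suc n) = nu \<mu> ^ Suc n / fact (Suc n) * (1 / (exp (nu \<mu>) - 1))"
  by (simp add: p_bar_def)

lemma p_bar_1:
  assumes "1 < \<mu>"
  shows "p_bar \<mu> 1 = \<mu> - nu \<mu>"
  using nu_equation[OF assms] nu_ge[OF assms] assms by (simp add: p_bar_def field_simps)

text \<open>
  On the occupied sites the equilibrium is reversible: particles arrive at rate \<open>nu \<mu>\<close> and leave at rate
  \<open>n\<close>.
\<close>

lemma p_bar_detailed_balance:
  "real (Suc (Suc n)) * p_bar \<mu> (Suc (Suc n)) = nu \<mu> * p_bar \<mu> (Suc n)"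
proof -
  have "real (Suc (Suc n)) * (nu \<mu> ^ Suc (Suc n) / fact (Suc (Suc n))) = nu \<mu> * (nu \<mu> ^ Suc n / fact (Suc n))"
    by (simp del: of_nat_Suc add: fact_Suc[of "Suc n"])
  then show ?thesis
    by (simp only: p_bar_Suc mult.assoc[symmetric])
qed

lemma p_bar_prob_dist:
  assumes "1 < \<mu>"
  shows "prob_dist (p_bar \<mu>)"
  unfolding prob_dist_def
proof
  have nu: "0 < nu \<mu>" using nu_ge[OF assms] assms by simp
  show "\<forall>n. 0 \<le> p_bar \<mu> n"
    using nu by (auto simp: p_bar_def)
  have "(\<lambda>n. nu \<mu> ^ n / fact n) sums exp (nu \<mu>)"
    using exp_converges[of "nu \<mu>"] by (simp add: divide_inverse mult.commute)
  then have "(\<lambda>n. nu \<mu> ^ Suc n / fact (Suc n)) sums (exp (nu \<mu>) - 1)"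
    by (subst sums_Suc_iff) simp
  then have "(\<lambda>n. nu \<mu> ^ Suc n / fact (Suc n) * (1 / (exp (nu \<mu>) - 1))) sums ((exp (nu \<mu>) - 1) * (1 / (exp (nu \<mu>) - 1)))"
    by (rule sums_mult2)
  moreover have "(exp (nu \<mu>) - 1) * (1 / (exp (nu \<mu>) - 1)) = 1"
    using nu by simp
  ultimately have "(\<lambda>n. p_bar \<mu> (Suc n)) sums 1"
    by (simp add: p_bar_def)
  then show "p_bar \<mu> sums 1"
    by (subst (asm) sums_Suc_iff) (simp add: p_bar_0)
qed

lemma p_bar_has_first_moment:
  assumes "1 < \<mu>"
  shows "has_first_moment (p_bar \<mu>)"
proof -
  have "summable (\<lambda>n. nu \<mu> * p_bar \<mu> (Suc n))"
    using p_bar_prob_dist[OF assms]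
    by (intro summable_mult) (auto simp: prob_dist_def sums_iff summable_Suc_iff)
  then show ?thesis
    unfolding has_first_moment_def p_bar_detailed_balance[symmetric]
    by (subst (asm) summable_Suc_iff) (subst (asm) summable_Suc_iff)
qed

section \<open>Contraction of the tails\<close>

lemma smoothed_abs_bounds:
  fixes x \<delta> :: real
  assumes "0 \<le> \<delta>"
  shows "\<bar>x\<bar> \<le> sqrt (x\<^sup>2 + \<delta>\<^sup>2)" "\<delta> \<le> sqrt (x\<^sup>2 + \<delta>\<^sup>2)" "sqrt (x\<^sup>2 + \<delta>\<^sup>2) \<le> \<bar>x\<bar> + \<delta>"
  using assms sqrt_sum_squares_le_sum_abs[of x \<delta>]
  by (auto intro: real_le_rsqrt)

lemma smoothed_abs_has_derivative:
  fixes f :: "real \<Rightarrow> real"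
  assumes "(f has_real_derivative d) (at t within S)" "0 < \<delta>"
  shows "((\<lambda>s. sqrt ((f s)\<^sup>2 + \<delta>\<^sup>2)) has_real_derivative f t * d / sqrt ((f t)\<^sup>2 + \<delta>\<^sup>2)) (at t within S)"
proof -
  have "0 < (f t)\<^sup>2 + \<delta>\<^sup>2"
    using assms(2) by (simp add: add_nonneg_pos)
  then show ?thesis
    by (auto intro!: derivative_eq_intros assms(1) simp: field_simps)
qed

text \<open>
  Differentiating \<open>\<bar>x\<bar>\<close> along \<open>x' = r - c * x\<close> should give at most \<open>\<bar>r\<bar> - c * \<bar>x\<bar>\<close>. Smoothing the
  absolute value makes this literally true at the zeros of \<open>x\<close>, at the price of \<open>c * \<delta>\<close>.
\<close>

lemma smoothed_abs_damping:
  fixes x \<delta> c r :: real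
  assumes "0 < \<delta>" "0 \<le> c"
  shows "x * (r - c * x) / sqrt (x\<^sup>2 + \<delta>\<^sup>2) \<le> \<bar>r\<bar> - c * sqrt (x\<^sup>2 + \<delta>\<^sup>2) + c * \<delta>"
proof -
  define s where "s = sqrt (x\<^sup>2 + \<delta>\<^sup>2)"
  have s: "\<bar>x\<bar> \<le> s" "\<delta> \<le> s" "0 < s"
    using smoothed_abs_bounds(1,2)[of \<delta> x] assms unfolding s_def by linarith+
  have s2: "s\<^sup>2 = x\<^sup>2 + \<delta>\<^sup>2" by (simp add: s_def)
  have "x * r \<le> \<bar>x\<bar> * \<bar>r\<bar>" by (metis abs_ge_self abs_mult)
  also have "\<dots> \<le> s * \<bar>r\<bar>" using s by (intro mult_right_mono) auto
  finally have "x * r \<le> s * \<bar>r\<bar>" .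
  moreover have "c * (\<delta> * \<delta>) \<le> c * (\<delta> * s)"
    using s assms by (intro mult_left_mono) auto
  ultimately have "x * (r - c * x) \<le> s * \<bar>r\<bar> - c * s\<^sup>2 + c * (\<delta> * s)"
    unfolding s2 by (simp add: algebra_simps power2_eq_square)
  then show ?thesis
    unfolding s_def[symmetric] pos_divide_le_eq[OF s(3)] by (simp add: algebra_simps power2_eq_square)
qed

text \<open>
  The decay rate 1 originates here. A tail difference at level \<open>m = n + 2\<close> is lost at rate \<open>m\<close>, while
  the level below gains it at rate \<open>m - 1\<close> only. At \<open>m = 2\<close> nothing is passed on, since singly occupied
  sites lose no particles; this leaves the additional \<open>- \<phi> 2\<close>.
\<close>

lemma sum_birth_death_generator:
  fixes \<phi> :: "nat \<Rightarrow> real"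
  shows "(\<Sum>n<N. a * \<phi> (Suc n) + real (n + 2) * \<phi> (n + 3) - (a + real (n + 2)) * \<phi> (n + 2))
    = a * (\<phi> 1 - \<phi> (N + 1)) + real (N + 1) * \<phi> (N + 2) - \<phi> 2 - (\<Sum>n<N. \<phi> (n + 2))"
  by (induction N) (auto simp: algebra_simps eval_nat_numeral)

text \<open>
  An exponential rate at which the empty sites provably disappear from the beginning, since the crowding
  is at least \<open>\<mu> - 1\<close>. Capping it below 1 keeps it away from the intrinsic rate of the tails.
\<close>

definition crude_rate :: "real \<Rightarrow> real"
  where "crude_rate \<mu> = min (1 / 2) (\<mu> - 1)"

definition total_mean :: "real \<Rightarrow> real"
  where "total_mean \<mu> = \<mu> + first_moment (p_bar \<mu>)"

text \<open>
  Bounds the deviation of the crowding from \<open>nu \<mu>\<close> in units of \<open>exp (- crude_rate \<mu> * t)\<close>, so that its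
  time integral is at most the exponent in the next definition.
\<close>

definition crude_const :: "real \<Rightarrow> real"
  where "crude_const \<mu> = 1 + total_mean \<mu> + (\<mu> + 1) / (1 - crude_rate \<mu>)"

definition emptying_const :: "real \<Rightarrow> real"
  where "emptying_const \<mu> = exp (crude_const \<mu> / crude_rate \<mu>)"

definition supercritical_const :: "real \<Rightarrow> real"
  where "supercritical_const \<mu> = 2 * (emptying_const \<mu> + total_mean \<mu>
    + (\<mu> + 1) * emptying_const \<mu> / (if nu \<mu> < 1 then 1 - nu \<mu> else 1))"

lemma total_mean_nonneg: "1 < \<mu> \<Longrightarrow> 0 \<le> total_mean \<mu>"
  by (simp add: total_mean_def first_moment_nonneg p_bar_prob_dist p_bar_has_first_moment)

locale supercritical_solution = dispersion_solution +
  assumes supercritical: "1 < first_moment (p 0)"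
begin

text \<open>
  The sum of the \<open>\<bar>gap t n\<bar>\<close> is the Wasserstein distance between \<open>p t\<close> and the equilibrium, the
  distance in which the system is dissipative.
\<close>

definition gap :: "real \<Rightarrow> nat \<Rightarrow> real"
  where "gap t n = tail (p t) n - tail (p_bar \<mu>) n"

lemma gap_0: "gap t 0 = 0"
  by (simp add: gap_def)

lemma gap_1: "gap t 1 = - p t 0"
  by (simp add: gap_def tail_def p_bar_0)

lemma gap_diff: "gap t n - gap t (Suc n) = p t n - p_bar \<mu> n"
  by (simp add: gap_def tail_Suc)

text \<open>
  As the means agree, the crowding deviates from its equilibrium value exactly by the deviation of the
  singly occupied sites. This turns the nonlinearity into a term controlled by two gaps.
\<close>

lemma crowding_gap:
  assumes "0 \<le> t"
  shows "crowding (p t) - nu \<mu> = gap t 2 - gap t 1"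
  using gap_diff[of t 1] p_bar_1[OF supercritical] crowding_eq[OF has_mean[OF assms]] mean_conserved[OF assms]
  by (simp add: eval_nat_numeral)

lemma gap_has_derivative:
  assumes "0 \<le> t"
  shows "((\<lambda>s. gap s (n + 2)) has_real_derivative
    crowding (p t) * gap t (Suc n) + real (n + 2) * gap t (n + 3)
      + (gap t 2 - gap t 1) * p_bar \<mu> (Suc n)
      - (crowding (p t) + real (n + 2)) * gap t (n + 2)) (at t within {0..})"
proof -
  have "((\<lambda>s. gap s (n + 2)) has_real_derivative
      (crowding (p t) * p t (Suc n) - real (n + 2) * p t (n + 2)) - 0) (at t within {0..})"
    unfolding gap_def using tail_has_derivative[OF assms, of "Suc n"]
    by (intro DERIV_diff DERIV_const) simp
  moreover have "crowding (p t) * p t (Suc n) - real (n + 2) * p t (n + 2)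
      = crowding (p t) * gap t (Suc n) + real (n + 2) * gap t (n + 3)
      + (gap t 2 - gap t 1) * p_bar \<mu> (Suc n)
      - (crowding (p t) + real (n + 2)) * gap t (n + 2)"
  proof -
    define g1 g2 g3 where "g1 = gap t (Suc n)" and "g2 = gap t (n + 2)" and "g3 = gap t (n + 3)"
    have 1: "p t (Suc n) = g1 - g2 + p_bar \<mu> (Suc n)"
      using gap_diff[of t "Suc n"] by (simp add: g1_def g2_def)
    have 2: "p t (n + 2) = g2 - g3 + p_bar \<mu> (n + 2)"
      using gap_diff[of t "n + 2"] by (simp add: g3_def g2_def eval_nat_numeral)
    have 3: "real (n + 2) * p_bar \<mu> (n + 2) = nu \<mu> * p_bar \<mu> (Suc n)"
      using p_bar_detailed_balance[of n \<mu>] by simp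
    show ?thesis
      unfolding crowding_gap[OF assms, symmetric] g1_def[symmetric] g2_def[symmetric] g3_def[symmetric]
      unfolding 1 2 using 3 by (simp add: algebra_simps)
  qed
  ultimately show ?thesis by simp
qed

definition smoothed_gap :: "real \<Rightarrow> real \<Rightarrow> nat \<Rightarrow> real"
  where "smoothed_gap \<delta> t n = sqrt ((gap t n)\<^sup>2 + \<delta>\<^sup>2)"

text \<open>
  The gaps at the levels \<open>n \<ge> 2\<close> form a closed system, driven only by \<open>gap t 1 = - p t 0\<close>. The
  nonlinear term has total weight \<open>\<bar>gap t 2 - gap t 1\<bar>\<close>, because \<open>p_bar\<close> has mass 1, and the additional
  damping at level 2 compensates its part \<open>\<bar>gap t 2\<bar>\<close> exactly. Hence the sum \<open>D\<close> of the gaps satisfies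
  \<open>D' \<le> - D + (a + 1) * p t 0\<close> with the crowding \<open>a\<close>.
\<close>

lemma sum_smoothed_gap_decay:
  assumes t: "0 \<le> t" and \<delta>: "0 < \<delta>"
  obtains d where
    "((\<lambda>s. \<Sum>n<N. smoothed_gap \<delta> s (n + 2)) has_real_derivative d) (at t within {0..})"
    "d \<le> (crowding (p t) + 1) * p t 0 - (\<Sum>n<N. smoothed_gap \<delta> t (n + 2))
      + excess (p t) (N + 2) + excess (p_bar \<mu>) (N + 2) + (\<mu> + 2) * (real (N + 1))\<^sup>2 * \<delta>"
proof -
  define a where "a = crowding (p t)"
  define b where "b = gap t 2 - gap t 1"
  define \<phi> where "\<phi> = smoothed_gap \<delta> t"
  define q where "q = p_bar \<mu>"
  have q: "prob_dist q" "has_first_moment q"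
    using p_bar_prob_dist[OF supercritical] p_bar_has_first_moment[OF supercritical] by (auto simp: q_def)
  have a: "0 \<le> a" "a \<le> \<mu>" using crowding_range[OF t] by (auto simp: a_def)
  have \<phi>: "\<bar>gap t n\<bar> \<le> \<phi> n" "0 \<le> \<phi> n" "\<phi> n \<le> \<bar>gap t n\<bar> + \<delta>" for n
    using smoothed_abs_bounds[of \<delta> "gap t n"] \<delta> by (auto simp: \<phi>_def smoothed_gap_def)
  define r where "r = (\<lambda>n. a * gap t (Suc n) + real (n + 2) * gap t (n + 3) + b * q (Suc n))"
  define d where "d = (\<lambda>n. gap t (n + 2) * (r n - (a + real (n + 2)) * gap t (n + 2)) / \<phi> (n + 2))"
  have deriv: "((\<lambda>s. \<Sum>n<N. smoothed_gap \<delta> s (n + 2)) has_real_derivative (\<Sum>n<N. d n)) (at t within {0..})"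
    unfolding smoothed_gap_def \<phi>_def d_def r_def a_def b_def q_def
    by (intro DERIV_sum smoothed_abs_has_derivative gap_has_derivative t \<delta>)
  have d_le: "d n \<le> (a * \<phi> (Suc n) + real (n + 2) * \<phi> (n + 3) - (a + real (n + 2)) * \<phi> (n + 2))
      + \<bar>b\<bar> * q (Suc n) + (\<mu> + real (N + 1)) * \<delta>" if "n < N" for n
  proof -
    have "d n \<le> \<bar>r n\<bar> - (a + real (n + 2)) * \<phi> (n + 2) + (a + real (n + 2)) * \<delta>"
      unfolding d_def \<phi>_def smoothed_gap_def using a \<delta> by (intro smoothed_abs_damping) auto
    also have "\<bar>r n\<bar> \<le> \<bar>a * gap t (Suc n)\<bar> + \<bar>real (n + 2) * gap t (n + 3)\<bar> + \<bar>b * q (Suc n)\<bar>"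
      unfolding r_def by linarith
    also have "\<dots> \<le> a * \<phi> (Suc n) + real (n + 2) * \<phi> (n + 3) + \<bar>b\<bar> * q (Suc n)"
      unfolding abs_mult using a \<phi> prob_dist_nonneg[OF q(1)]
      by (intro add_mono mult_mono) auto
    also have "(a + real (n + 2)) * \<delta> \<le> (\<mu> + real (N + 1)) * \<delta>"
      using a that \<delta> by (intro mult_right_mono) auto
    finally show ?thesis by simp
  qed
  have q_sum: "(\<Sum>n<N. q (Suc n)) \<le> 1"
    using prob_dist_sum_le_1[OF q(1), of "Suc N"] prob_dist_nonneg[OF q(1), of 0]
    by (simp only: sum.lessThan_Suc_shift)
  have "(\<Sum>n<N. d n) \<le> (\<Sum>n<N. (a * \<phi> (Suc n) + real (n + 2) * \<phi> (n + 3) - (a + real (n + 2)) * \<phi> (n + 2))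
      + \<bar>b\<bar> * q (Suc n) + (\<mu> + real (N + 1)) * \<delta>)"
    by (intro sum_mono d_le) simp
  also have "\<dots> = a * (\<phi> 1 - \<phi> (N + 1)) + real (N + 1) * \<phi> (N + 2) - \<phi> 2 - (\<Sum>n<N. \<phi> (n + 2))
      + \<bar>b\<bar> * (\<Sum>n<N. q (Suc n)) + real N * ((\<mu> + real (N + 1)) * \<delta>)"
    unfolding sum.distrib sum_birth_death_generator by (simp add: sum_distrib_left)
  also have "\<bar>b\<bar> * (\<Sum>n<N. q (Suc n)) \<le> \<bar>b\<bar> * 1"
    using q_sum by (intro mult_left_mono) auto
  also have "\<bar>b\<bar> * 1 \<le> \<phi> 1 + \<phi> 2"
    using \<phi>(1)[of 1] \<phi>(1)[of 2] by (simp add: b_def)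
  also have "a * (\<phi> 1 - \<phi> (N + 1)) \<le> a * \<phi> 1"
    using a \<phi> by (intro mult_left_mono) auto
  also have "real (N + 1) * \<phi> (N + 2) \<le> real (N + 1) * (\<bar>gap t (N + 2)\<bar> + \<delta>)"
    using \<phi>(3)[of "N + 2"] by (intro mult_left_mono) auto
  finally have "(\<Sum>n<N. d n) \<le> (a + 1) * \<phi> 1 + real (N + 1) * \<bar>gap t (N + 2)\<bar> - (\<Sum>n<N. \<phi> (n + 2))
      + real N * ((\<mu> + real (N + 1)) * \<delta>) + real (N + 1) * \<delta>"
    by (simp add: algebra_simps)
  also have "(a + 1) * \<phi> 1 \<le> (a + 1) * (p t 0 + \<delta>)"
    using \<phi>(3)[of 1] a prob_dist_nonneg[OF prob[OF t], of 0] unfolding gap_1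
    by (intro mult_left_mono) auto
  also have "\<dots> \<le> (a + 1) * p t 0 + (\<mu> + 1) * \<delta>"
    using a \<delta> by (simp add: algebra_simps)
  also have "real (N + 1) * \<bar>gap t (N + 2)\<bar> \<le> excess (p t) (N + 2) + excess q (N + 2)"
  proof -
    have "\<bar>gap t (N + 2)\<bar> \<le> tail (p t) (N + 2) + tail q (N + 2)"
      using tail_nonneg[OF prob[OF t], of "N + 2"] tail_nonneg[OF q(1), of "N + 2"]
      unfolding gap_def q_def by linarith
    then have "real (N + 1) * \<bar>gap t (N + 2)\<bar> \<le> real (N + 2) * (tail (p t) (N + 2) + tail q (N + 2))"
      by (intro mult_mono) auto
    also have "\<dots> \<le> excess (p t) (N + 2) + excess q (N + 2)"
      unfolding distrib_left by (intro add_mono excess_ge_tail prob has_mean q t)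
    finally show ?thesis .
  qed
  also have "real N * ((\<mu> + real (N + 1)) * \<delta>) \<le> (\<mu> + 2) * (real (N + 1))\<^sup>2 * \<delta> - (\<mu> + 1) * \<delta> - real (N + 1) * \<delta>"
  proof -
    have "0 \<le> (2 * real N + \<mu> * real N * (1 + real N)) * \<delta> + real N * real N * \<delta>"
      using a \<delta> by (intro add_nonneg_nonneg mult_nonneg_nonneg) auto
    then show ?thesis by (simp add: power2_eq_square algebra_simps)
  qed
  finally have "(\<Sum>n<N. d n) \<le> (a + 1) * p t 0 - (\<Sum>n<N. \<phi> (n + 2))
      + excess (p t) (N + 2) + excess q (N + 2) + (\<mu> + 2) * (real (N + 1))\<^sup>2 * \<delta>"
    by simp
  then show ?thesis
    using deriv by (intro that) (auto simp: a_def \<phi>_def q_def)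
qed

lemma sum_gap_0_le: "(\<Sum>n<N. \<bar>gap 0 (n + 2)\<bar>) \<le> total_mean \<mu>"
proof -
  have shifted: "(\<Sum>n<N. tail q (n + 2)) \<le> first_moment q"
    if "prob_dist q" "has_first_moment q" for q
    using sum_tails_le_first_moment[OF that, of "Suc N"] tail_nonneg[OF that(1), of 1]
    by (simp add: sum.lessThan_Suc_shift del: sum.lessThan_Suc)
  have "(\<Sum>n<N. \<bar>gap 0 (n + 2)\<bar>) \<le> (\<Sum>n<N. tail (p 0) (n + 2) + tail (p_bar \<mu>) (n + 2))"
  proof (rule sum_mono)
    show "\<bar>gap 0 (n + 2)\<bar> \<le> tail (p 0) (n + 2) + tail (p_bar \<mu>) (n + 2)" for n
      using tail_nonneg[OF prob, of 0 "n + 2"] tail_nonneg[OF p_bar_prob_dist[OF supercritical], of "n + 2"]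
      unfolding gap_def by linarith
  qed
  also have "\<dots> \<le> total_mean \<mu>"
    unfolding sum.distrib total_mean_def
    by (intro add_mono shifted prob has_mean p_bar_prob_dist p_bar_has_first_moment supercritical) auto
  finally show ?thesis .
qed

text \<open>
  The integrated form of the previous inequality, where \<open>h\<close> is a primitive of an upper bound for its
  source. The bound on the initial gaps by \<open>total_mean \<mu>\<close> makes the estimate depend on the data through
  the mean only.
\<close>

lemma sum_gap_duhamel:
  fixes h h' :: "real \<Rightarrow> real"
  assumes T: "0 \<le> T"
    and h: "\<And>t. (h has_real_derivative h' t) (at t)"
    and source: "\<And>t. 0 \<le> t \<Longrightarrow> exp t * ((crowding (p t) + 1) * p t 0) \<le> h' t"
  shows "exp T * (\<Sum>n<m. \<bar>gap T (n + 2)\<bar>) \<le> total_mean \<mu> + (h T - h 0)"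
proof -
  \<comment> \<open>The smoothing error grows quadratically with the truncation level; this choice beats it.\<close>
  define \<delta> where "\<delta> = (\<lambda>N. inverse (real (Suc N)) ^ 3)"
  have \<delta>: "0 < \<delta> N" for N by (simp add: \<delta>_def)
  have \<delta>_eq: "(real (Suc N))\<^sup>2 * \<delta> N = inverse (real (Suc N))" for N
  proof -
    define r where "r = real (Suc N)"
    have "r\<^sup>2 * inverse r ^ 3 = (r * inverse r)\<^sup>2 * inverse r"
      by (simp only: power2_eq_square power3_eq_cube mult_ac)
    moreover have "r * inverse r = 1"
      by (simp add: r_def)
    ultimately show ?thesis
      unfolding \<delta>_def r_def[symmetric] by (simp only: power_one mult_1_left)
  qed
  define S where "S = (\<lambda>N t. \<Sum>n<N. smoothed_gap (\<delta> N) t (n + 2))"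
  define q where "q = p_bar \<mu>"
  have q: "prob_dist q" "has_first_moment q"
    using p_bar_prob_dist[OF supercritical] p_bar_has_first_moment[OF supercritical] by (auto simp: q_def)
  define E where "E = (\<lambda>N t. excess (p t) (N + 2) + excess q (N + 2) + (\<mu> + 2) * inverse (real (Suc N)))"
  \<comment> \<open>A derivative is selected for every truncation level and time.\<close>
  define is_rate where "is_rate = (\<lambda>N t d. (S N has_real_derivative d) (at t within {0..})
    \<and> d \<le> (crowding (p t) + 1) * p t 0 - S N t + E N t)"
  define S' where "S' = (\<lambda>N t. SOME d. is_rate N t d)"
  have S': "is_rate N t (S' N t)" if t: "0 \<le> t" for N t
    unfolding S'_def
  proof (rule someI_ex)
    obtain d where d: "((\<lambda>s. \<Sum>n<N. smoothed_gap (\<delta> N) s (n + 2)) has_real_derivative d) (at t within {0..})"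
      "d \<le> (crowding (p t) + 1) * p t 0 - (\<Sum>n<N. smoothed_gap (\<delta> N) t (n + 2))
        + excess (p t) (N + 2) + excess (p_bar \<mu>) (N + 2) + (\<mu> + 2) * (real (N + 1))\<^sup>2 * \<delta> N"
      by (rule sum_smoothed_gap_decay[OF t \<delta>, of N N])
    have "(\<mu> + 2) * (real (N + 1))\<^sup>2 * \<delta> N = (\<mu> + 2) * inverse (real (Suc N))"
      using \<delta>_eq[of N] by (simp only: mult.assoc Suc_eq_plus1)
    with d(2) have "d \<le> (crowding (p t) + 1) * p t 0 - S N t + E N t"
      unfolding S_def E_def q_def by linarith
    with d(1) have "is_rate N t d"
      unfolding is_rate_def S_def by (rule conjI)
    then show "\<exists>d. is_rate N t d" ..
  qed
  have E_nonneg: "0 \<le> E N t" if "0 \<le> t" for N t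
    unfolding E_def using supercritical
    by (intro add_nonneg_nonneg mult_nonneg_nonneg excess_nonneg prob has_mean q that) auto
  define F where "F = (\<lambda>N t. exp t * S N t)"
  define e where "e = (\<lambda>N t. exp t * E N t)"
  obtain \<eta> where eta: "\<eta> \<longlonglongrightarrow> 0" "\<And>N. F N T \<le> F N 0 + (h T - h 0) + \<eta> N"
  proof (rule differential_inequalities_with_vanishing_error
      [where F = F and F' = "\<lambda>N t. exp t * S N t + S' N t * exp t" and e = e and T = T
        and B = "exp T * (\<mu> + first_moment q + (\<mu> + 2) * 1)" and g = h and g' = h'])
    fix N t assume tT: "t \<in> {0..T}"
    then have t: "0 \<le> t" by simp
    have dS: "(S N has_real_derivative S' N t) (at t within {0..T})"
      using S'[OF t, of N] unfolding is_rate_def by (auto intro: DERIV_subset)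
    show "(F N has_real_derivative exp t * S N t + S' N t * exp t) (at t within {0..T})"
      unfolding F_def by (rule derivative_eq_intros dS refl)+ simp
    have "exp t * (S N t + S' N t) \<le> exp t * ((crowding (p t) + 1) * p t 0 + E N t)"
      using S'[OF t, of N] unfolding is_rate_def by (intro mult_left_mono) auto
    then show "exp t * S N t + S' N t * exp t \<le> h' t + e N t"
      using source[OF t] by (simp add: e_def algebra_simps)
    have "\<bar>e N t\<bar> = e N t"
      using E_nonneg[OF t, of N] by (simp add: e_def)
    also have "\<dots> \<le> exp T * (\<mu> + first_moment q + (\<mu> + 2) * 1)"
      unfolding e_def
    proof (intro mult_mono E_nonneg t)
      show "E N t \<le> \<mu> + first_moment q + (\<mu> + 2) * 1"
        unfolding E_def using supercritical
        by (intro add_mono excess_range(2) t excess_le q mult_left_mono) (auto simp: field_simps)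
    qed (use tT in auto)
    finally show "\<bar>e N t\<bar> \<le> exp T * (\<mu> + first_moment q + (\<mu> + 2) * 1)" .
  next
    show "continuous_on {0..T} (e N)" for N
      unfolding e_def E_def by (intro continuous_intros continuous_on_Icc) auto
  next
    fix t assume "t \<in> {0..T}"
    then have t: "0 \<le> t" by simp
    have "(\<lambda>N. exp t * (excess (p t) (N + 2) + excess q (N + 2) + (\<mu> + 2) * inverse (real (Suc N))))
      \<longlonglongrightarrow> exp t * (0 + 0 + (\<mu> + 2) * 0)"
      by (intro tendsto_intros excess_tendsto_0[THEN LIMSEQ_ignore_initial_segment] has_mean t q
          LIMSEQ_inverse_real_of_nat)
    then show "(\<lambda>N. e N t) \<longlonglongrightarrow> 0" by (simp add: e_def E_def)
  next
    show "(h has_real_derivative h' t) (at t within {0..T})" for t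
      using h by (rule has_field_derivative_at_within)
  qed (use T in auto)
  have lower: "exp T * (\<Sum>n<m. \<bar>gap T (n + 2)\<bar>) \<le> F N T" if "m \<le> N" for N
  proof -
    have "(\<Sum>n<m. \<bar>gap T (n + 2)\<bar>) \<le> (\<Sum>n<N. \<bar>gap T (n + 2)\<bar>)"
      using that by (intro sum_mono2) auto
    also have "\<dots> \<le> S N T"
      unfolding S_def smoothed_gap_def
      by (intro sum_mono smoothed_abs_bounds less_imp_le[OF \<delta>])
    finally show ?thesis by (simp add: F_def)
  qed
  have upper: "F N 0 \<le> total_mean \<mu> + inverse (real (Suc N))" for N
  proof -
    have "F N 0 \<le> (\<Sum>n<N. \<bar>gap 0 (n + 2)\<bar> + \<delta> N)"
      unfolding F_def S_def smoothed_gap_def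
      by (simp del: of_nat_Suc add: sum_mono smoothed_abs_bounds less_imp_le[OF \<delta>])
    also have "\<dots> \<le> total_mean \<mu> + real N * \<delta> N"
      using sum_gap_0_le[of N] by (simp add: sum.distrib)
    also have "real N * \<delta> N \<le> (real (Suc N))\<^sup>2 * \<delta> N"
      using \<delta>[of N] by (intro mult_right_mono) (auto simp: power2_eq_square algebra_simps)
    also have "\<dots> = inverse (real (Suc N))"
      using \<delta>_eq by simp
    finally show ?thesis by simp
  qed
  have "(\<lambda>N. total_mean \<mu> + inverse (real (Suc N)) + (h T - h 0) + \<eta> N) \<longlonglongrightarrow> total_mean \<mu> + 0 + (h T - h 0) + 0"
    by (intro tendsto_intros LIMSEQ_inverse_real_of_nat eta)
  then have "exp T * (\<Sum>n<m. \<bar>gap T (n + 2)\<bar>) \<le> total_mean \<mu> + 0 + (h T - h 0) + 0"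
  proof (rule LIMSEQ_le_const)
    have "exp T * (\<Sum>n<m. \<bar>gap T (n + 2)\<bar>) \<le> total_mean \<mu> + inverse (real (Suc N)) + (h T - h 0) + \<eta> N"
      if "m \<le> N" for N
      using lower[OF that] eta(2)[of N] upper[of N] by linarith
    then show "\<exists>K. \<forall>N\<ge>K. exp T * (\<Sum>n<m. \<bar>gap T (n + 2)\<bar>)
        \<le> total_mean \<mu> + inverse (real (Suc N)) + (h T - h 0) + \<eta> N"
      by blast
  qed
  then show ?thesis by simp
qed

section \<open>Bootstrapping the decay rate\<close>

text \<open>
  An empty site stays empty until a particle arrives, so \<open>p t 0\<close> is damped by the crowding alone: a lower
  bound for the crowding is a decay rate for the empty sites.
\<close>

lemma empty_sites_decay:
  assumes T: "0 \<le> T"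
    and A: "\<And>t. (A has_real_derivative A' t) (at t)"
    and le: "\<And>t. 0 \<le> t \<Longrightarrow> A' t \<le> crowding (p t)"
  shows "p T 0 \<le> exp (A 0 - A T)"
proof -
  have "p T 0 * exp (A T) \<le> p 0 0 * exp (A 0)"
  proof (rule nonincreasing_from_nonpos_derivative[OF T])
    fix t assume "t \<in> {0..T}"
    then have t: "0 \<le> t" by simp
    have dp: "((\<lambda>s. p s 0) has_real_derivative dispersion_rhs (p t) 0) (at t within {0..T})"
      by (intro DERIV_subset[OF has_derivative_at_site[OF t]]) auto
    show "((\<lambda>t. p t 0 * exp (A t)) has_real_derivative (A' t - crowding (p t)) * (p t 0 * exp (A t))) (at t within {0..T})"
      by (rule derivative_eq_intros dp has_field_derivative_at_within[OF A] refl)+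
        (simp add: dispersion_rhs_def algebra_simps)
    show "(A' t - crowding (p t)) * (p t 0 * exp (A t)) \<le> 0"
      using le[OF t] prob_dist_nonneg[OF prob[OF t], of 0] by (intro mult_nonpos_nonneg) auto
  qed
  also have "\<dots> \<le> 1 * exp (A 0)"
    using prob_dist_le_1[OF prob, of 0 0] by (intro mult_right_mono) auto
  finally show ?thesis by (simp add: exp_diff pos_le_divide_eq)
qed

lemma crude_rate: "0 < crude_rate \<mu>" "crude_rate \<mu> \<le> \<mu> - 1" "crude_rate \<mu> < 1"
  using supercritical by (auto simp: crude_rate_def)

lemma crude_empty_sites_decay:
  assumes T: "0 \<le> T"
  shows "p T 0 \<le> exp (- crude_rate \<mu> * T)"
proof -
  have "p T 0 \<le> exp (crude_rate \<mu> * 0 - crude_rate \<mu> * T)"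
  proof (rule empty_sites_decay[OF T, where A' = "\<lambda>_. crude_rate \<mu>"])
    show "((*) (crude_rate \<mu>) has_real_derivative crude_rate \<mu>) (at t)" for t
      by (rule derivative_eq_intros refl)+ simp
    show "crude_rate \<mu> \<le> crowding (p t)" if "0 \<le> t" for t
      using crude_rate(2) prob_dist_le_1[OF prob[OF that], of 1]
      by (simp add: crowding_eq[OF has_mean[OF that]] mean_conserved[OF that])
  qed
  then show ?thesis by simp
qed

lemma source_le:
  assumes t: "0 \<le> t" and c: "p t 0 \<le> c"
  shows "exp t * ((crowding (p t) + 1) * p t 0) \<le> exp t * ((\<mu> + 1) * c)"
  using crowding_range[OF t] prob_dist_nonneg[OF prob[OF t], of 0] c
  by (intro mult_left_mono mult_mono) auto

text \<open>
  A source decaying at a rate \<open>\<kappa> < 1\<close> is slower than the damping, so the gaps inherit its rate.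
\<close>

lemma sum_gap_exponential_bound:
  assumes T: "0 \<le> T" and \<kappa>: "\<kappa> < 1" and "0 \<le> c"
    and p0: "\<And>t. 0 \<le> t \<Longrightarrow> p t 0 \<le> c * exp (- \<kappa> * t)"
  shows "(\<Sum>n<m. \<bar>gap T (n + 2)\<bar>) \<le> (total_mean \<mu> + (\<mu> + 1) * c / (1 - \<kappa>)) * exp (- \<kappa> * T)"
proof -
  define k where "k = (\<mu> + 1) * c / (1 - \<kappa>)"
  have k: "0 \<le> k" using supercritical assms by (simp add: k_def)
  have "exp T * (\<Sum>n<m. \<bar>gap T (n + 2)\<bar>) \<le> total_mean \<mu> + (k * exp ((1 - \<kappa>) * T) - k * exp ((1 - \<kappa>) * 0))"
  proof (rule sum_gap_duhamel[OF T, where h' = "\<lambda>t. (\<mu> + 1) * c * exp ((1 - \<kappa>) * t)"])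
    show "((\<lambda>t. k * exp ((1 - \<kappa>) * t)) has_real_derivative (\<mu> + 1) * c * exp ((1 - \<kappa>) * t)) (at t)" for t
      using \<kappa> by (auto intro!: derivative_eq_intros simp: k_def)
    show "exp t * ((crowding (p t) + 1) * p t 0) \<le> (\<mu> + 1) * c * exp ((1 - \<kappa>) * t)" if "0 \<le> t" for t
      using source_le[OF that p0[OF that]] by (simp add: algebra_simps exp_diff exp_minus divide_inverse)
  qed
  also have "\<dots> \<le> (total_mean \<mu> + k) * exp ((1 - \<kappa>) * T)"
  proof -
    have "total_mean \<mu> * 1 \<le> total_mean \<mu> * exp ((1 - \<kappa>) * T)"
      using \<kappa> T total_mean_nonneg[OF supercritical] by (intro mult_left_mono) auto
    then show ?thesis using k by (simp add: algebra_simps)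
  qed
  finally have "exp T * (\<Sum>n<m. \<bar>gap T (n + 2)\<bar>) \<le> exp T * ((total_mean \<mu> + k) * exp (- \<kappa> * T))"
    by (simp add: algebra_simps exp_diff exp_minus divide_inverse)
  then show ?thesis by (simp add: k_def)
qed

lemma crowding_ge:
  assumes t: "0 \<le> t"
  shows "nu \<mu> - crude_const \<mu> * exp (- crude_rate \<mu> * t) \<le> crowding (p t)"
proof -
  have "(\<Sum>n<1. \<bar>gap t (n + 2)\<bar>)
      \<le> (total_mean \<mu> + (\<mu> + 1) * 1 / (1 - crude_rate \<mu>)) * exp (- crude_rate \<mu> * t)"
    using crude_rate crude_empty_sites_decay by (intro sum_gap_exponential_bound t) auto
  then have "\<bar>gap t 2\<bar> \<le> (crude_const \<mu> - 1) * exp (- crude_rate \<mu> * t)"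
    by (simp add: crude_const_def numeral_2_eq_2)
  moreover have "gap t 1 \<le> 0"
    using prob_dist_nonneg[OF prob[OF t], of 0] by (simp only: gap_1)
  ultimately show ?thesis
    using crowding_gap[OF t] exp_gt_zero[of "- crude_rate \<mu> * t"] unfolding left_diff_distrib by linarith
qed

text \<open>
  The crowding falls short of \<open>nu \<mu>\<close> only by an integrable amount, which costs a constant factor and no
  loss in the exponent.
\<close>

lemma empty_sites_sharp_decay:
  assumes T: "0 \<le> T"
  shows "p T 0 \<le> emptying_const \<mu> * exp (- nu \<mu> * T)"
proof -
  define \<kappa> where "\<kappa> = crude_rate \<mu>"
  define c where "c = crude_const \<mu>"
  have \<kappa>: "0 < \<kappa>" using crude_rate by (simp add: \<kappa>_def)
  have c: "0 \<le> c"
    using supercritical crude_rate total_mean_nonneg[OF supercritical] by (simp add: c_def crude_const_def)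
  \<comment> \<open>A primitive of the lower bound for the crowding.\<close>
  define A where "A = (\<lambda>t. nu \<mu> * t + c / \<kappa> * exp (- \<kappa> * t))"
  have "p T 0 \<le> exp (A 0 - A T)"
  proof (rule empty_sites_decay[OF T])
    show "(A has_real_derivative nu \<mu> - c * exp (- \<kappa> * t)) (at t)" for t
      unfolding A_def using \<kappa> by (auto intro!: derivative_eq_intros)
  qed (use crowding_ge in \<open>simp add: c_def \<kappa>_def\<close>)
  also have "\<dots> \<le> exp (c / \<kappa> - nu \<mu> * T)"
    using c \<kappa> by (simp add: A_def)
  also have "\<dots> = emptying_const \<mu> * exp (- nu \<mu> * T)"
    by (simp add: emptying_const_def c_def \<kappa>_def exp_diff exp_minus divide_inverse)
  finally show ?thesis .
qed

lemma l1_distance_le_gaps: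
  assumes t: "0 \<le> t" and D: "\<And>m. (\<Sum>n<m. \<bar>gap t (n + 2)\<bar>) \<le> D"
  shows "l1_norm (\<lambda>n. p t n - p_bar \<mu> n) \<le> 2 * (p t 0 + D)"
proof -
  have total: "(\<Sum>n<Suc N. \<bar>gap t n\<bar>) \<le> p t 0 + D" for N
  proof -
    have "(\<Sum>n<Suc N. \<bar>gap t n\<bar>) \<le> (\<Sum>n<Suc (Suc N). \<bar>gap t n\<bar>)" by simp
    also have "\<dots> = \<bar>gap t 0\<bar> + (\<bar>gap t 1\<bar> + (\<Sum>n<N. \<bar>gap t (n + 2)\<bar>))"
      by (simp only: sum.lessThan_Suc_shift) simp
    also have "\<dots> \<le> p t 0 + D"
      using D[of N] prob_dist_nonneg[OF prob[OF t], of 0] unfolding gap_0 gap_1 by simp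
    finally show ?thesis .
  qed
  have partial: "(\<Sum>n<N. \<bar>p t n - p_bar \<mu> n\<bar>) \<le> 2 * (p t 0 + D)" for N
  proof -
    have "(\<Sum>n<N. \<bar>p t n - p_bar \<mu> n\<bar>) \<le> (\<Sum>n<N. \<bar>gap t n\<bar> + \<bar>gap t (Suc n)\<bar>)"
      unfolding gap_diff[symmetric] by (intro sum_mono) linarith
    also have "\<dots> \<le> (\<Sum>n<Suc N. \<bar>gap t n\<bar>) + (\<Sum>n<Suc N. \<bar>gap t n\<bar>)"
      unfolding sum.distrib
    proof (rule add_mono)
      show "(\<Sum>n<N. \<bar>gap t (Suc n)\<bar>) \<le> (\<Sum>n<Suc N. \<bar>gap t n\<bar>)"
        unfolding sum.lessThan_Suc_shift by simp
    qed simp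
    also have "\<dots> \<le> 2 * (p t 0 + D)"
      unfolding mult_2 by (intro add_mono total)
    finally show ?thesis .
  qed
  have "summable (\<lambda>n. \<bar>p t n - p_bar \<mu> n\<bar>)"
    by (intro summableI_nonneg_bounded[where x = "2 * (p t 0 + D)"] partial abs_ge_zero)
  then show ?thesis
    unfolding l1_norm_def by (rule suminf_le_const) (rule partial)
qed

lemma slow_emptying_bound:
  assumes t: "0 \<le> t" and nu: "nu \<mu> < 1"
  shows "l1_norm (\<lambda>n. p t n - p_bar \<mu> n) \<le> supercritical_const \<mu> * exp (- nu \<mu> * t)"
proof -
  have "l1_norm (\<lambda>n. p t n - p_bar \<mu> n)
      \<le> 2 * (p t 0 + (total_mean \<mu> + (\<mu> + 1) * emptying_const \<mu> / (1 - nu \<mu>)) * exp (- nu \<mu> * t))"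
    using empty_sites_sharp_decay nu t
    by (intro l1_distance_le_gaps sum_gap_exponential_bound) (auto simp: emptying_const_def)
  also have "\<dots> \<le> supercritical_const \<mu> * exp (- nu \<mu> * t)"
    using empty_sites_sharp_decay[OF t] nu by (simp add: supercritical_const_def algebra_simps)
  finally show ?thesis .
qed

text \<open>
  Now the empty sites decay at least as fast as the intrinsic rate 1 of the tails, so the source in
  \<open>sum_gap_duhamel\<close> is merely bounded and produces a linear factor in time.
\<close>

lemma fast_emptying_bound:
  assumes t: "0 \<le> t" and nu: "1 \<le> nu \<mu>"
  shows "l1_norm (\<lambda>n. p t n - p_bar \<mu> n) \<le> supercritical_const \<mu> * japanese_bracket t * exp (- t)"
proof -
  define c where "c = emptying_const \<mu>"
  have c: "0 < c" by (simp add: c_def emptying_const_def)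
  have p0: "p s 0 \<le> c * exp (- s)" if "0 \<le> s" for s
  proof -
    have "exp (- nu \<mu> * s) \<le> exp (- s)"
      using mult_right_mono[OF nu that] by simp
    then have "c * exp (- nu \<mu> * s) \<le> c * exp (- s)"
      using c by (intro mult_left_mono) auto
    then show ?thesis
      using empty_sites_sharp_decay[OF that] unfolding c_def by linarith
  qed
  have "exp t * (\<Sum>n<m. \<bar>gap t (n + 2)\<bar>) \<le> total_mean \<mu> + ((\<mu> + 1) * c * t - (\<mu> + 1) * c * 0)" for m
  proof (rule sum_gap_duhamel[OF t, where h' = "\<lambda>_. (\<mu> + 1) * c"])
    show "((*) ((\<mu> + 1) * c) has_real_derivative (\<mu> + 1) * c) (at s)" for s
      by (rule derivative_eq_intros refl)+ simp
    show "exp s * ((crowding (p s) + 1) * p s 0) \<le> (\<mu> + 1) * c" if "0 \<le> s" for s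
    proof -
      have "exp s * ((\<mu> + 1) * (c * exp (- s))) = (\<mu> + 1) * c"
        by (simp add: exp_minus)
      then show ?thesis
        using source_le[OF that p0[OF that]] by linarith
    qed
  qed
  then have "l1_norm (\<lambda>n. p t n - p_bar \<mu> n) \<le> 2 * (p t 0 + (total_mean \<mu> + (\<mu> + 1) * c * t) * exp (- t))"
    by (intro l1_distance_le_gaps t) (simp add: exp_minus field_simps)
  also have "\<dots> \<le> 2 * (c + total_mean \<mu> + (\<mu> + 1) * c * t) * exp (- t)"
    using p0[OF t] by (simp add: algebra_simps)
  also have "\<dots> \<le> supercritical_const \<mu> * japanese_bracket t * exp (- t)"
  proof (rule mult_right_mono)
    have j: "1 \<le> japanese_bracket t" "t \<le> japanese_bracket t"
      by (auto simp: japanese_bracket_def intro: real_le_rsqrt)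
    have "(c + total_mean \<mu>) * 1 \<le> (c + total_mean \<mu>) * japanese_bracket t"
      using j c total_mean_nonneg[OF supercritical] by (intro mult_left_mono) auto
    moreover have "(\<mu> + 1) * c * t \<le> (\<mu> + 1) * c * japanese_bracket t"
      using j c supercritical by (intro mult_left_mono) auto
    ultimately show "2 * (c + total_mean \<mu> + (\<mu> + 1) * c * t) \<le> supercritical_const \<mu> * japanese_bracket t"
      using nu by (simp add: supercritical_const_def c_def algebra_simps)
  qed simp
  finally show ?thesis .
qed

end

section \<open>Convergence to equilibrium\<close>

theorem theorem1:
  shows "\<exists>(C\<^sub>2 :: real \<Rightarrow> real) (C\<^sub>1 :: real \<Rightarrow> real) (K :: real \<Rightarrow> real).
    (\<forall>x. 0 < C\<^sub>2 x) \<and> (\<forall>x. 0 < C\<^sub>1 x) \<and> (\<forall>x. 0 < K x) \<and>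
    (\<forall>(p0 :: nat \<Rightarrow> real) (p :: real \<Rightarrow> nat \<Rightarrow> real) (\<mu> :: real).
       prob_dist p0 \<longrightarrow> has_first_moment p0 \<longrightarrow> \<mu> = first_moment p0 \<longrightarrow> 0 < \<mu> \<longrightarrow>
       (\<mu> \<le> 1 \<longrightarrow> has_second_moment p0) \<longrightarrow>
       classical_solution p \<longrightarrow> p 0 = p0 \<longrightarrow>
       (\<forall>t>0.
         (0 < \<mu> \<and> \<mu> < 1 \<longrightarrow>
            l1_norm (\<lambda>n. p t n - p_star \<mu> n)
              \<le> C\<^sub>2 (second_moment p0) * exp (- 2 * (1 - \<mu>) * t)) \<and>
         (\<mu> = 1 \<longrightarrow>
            l1_norm (\<lambda>n. p t n - p_star \<mu> n)
              \<le> C\<^sub>2 (second_moment p0) * (1 / t)) \<and>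
         (1 < \<mu> \<and> \<mu> < exp 1 / (exp 1 - 1) \<longrightarrow>
            l1_norm (\<lambda>n. p t n - p_bar \<mu> n)
              \<le> C\<^sub>1 \<mu> * japanese_bracket t powr (1 / 2) * exp (- nu \<mu> * t)) \<and>
         (exp 1 / (exp 1 - 1) \<le> \<mu> \<longrightarrow>
            l1_norm (\<lambda>n. p t n - p_bar \<mu> n)
              \<le> C\<^sub>1 \<mu> * japanese_bracket t powr (K \<mu> + 1 / 2) * exp (- t))))"
proof (rule exI[of _ "\<lambda>x. 8 * (1 + \<bar>x\<bar>)"], rule exI[of _ "\<lambda>\<mu>. max 1 (supercritical_const \<mu>)"],
    rule exI[of _ "\<lambda>_. 1 / 2"], intro conjI allI impI)
  fix p0 :: "nat \<Rightarrow> real" and p :: "real \<Rightarrow> nat \<Rightarrow> real" and \<mu> t :: real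
  assume p0: "prob_dist p0" and \<mu>: "\<mu> = first_moment p0"
    and second: "\<mu> \<le> 1 \<longrightarrow> has_second_moment p0"
    and sol: "classical_solution p" and init: "p 0 = p0" and "0 < t"
  interpret dispersion_solution p
    by (rule dispersion_solution.intro) (rule sol)
  have t: "0 \<le> t" using \<open>0 < t\<close> by simp
  have l1_star: "l1_norm (\<lambda>n. p t n - p_star \<mu> n) = 2 * crowding (p t)"
    using l1_distance_to_p_star[OF prob[OF t] has_mean[OF t]] by (simp add: mean_conserved[OF t] init \<mu>)
  have bracket: "1 \<le> japanese_bracket t"
    by (simp add: japanese_bracket_def)
  {
    assume "0 < \<mu> \<and> \<mu> < 1"
    with second p0 have sum: "summable (\<lambda>n. pair_weight n * p 0 n)"
      and pm: "pair_moment (p 0) \<le> second_moment p0"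
      using pair_moment_le_second_moment[of p0] by (auto simp: init)
    have "2 * crowding (p t) \<le> 2 * (exp (- 2 * (1 - \<mu>) * t) * pair_moment (p 0))"
      using crowding_le_pair_moment[OF sum t] pair_moment_decay[OF sum t] \<open>0 < \<mu> \<and> \<mu> < 1\<close>
      by (simp add: init \<mu>)
    also have "\<dots> \<le> 8 * (1 + \<bar>second_moment p0\<bar>) * exp (- 2 * (1 - \<mu>) * t)"
    proof -
      have "2 * pair_moment (p 0) \<le> 8 * (1 + \<bar>second_moment p0\<bar>)"
        using pm abs_ge_self[of "second_moment p0"] abs_ge_zero[of "second_moment p0"]
        unfolding distrib_left by linarith
      from mult_right_mono[OF this exp_ge_zero[of "- 2 * (1 - \<mu>) * t"]] show ?thesis
        by (simp add: mult_ac)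
    qed
    finally show "l1_norm (\<lambda>n. p t n - p_star \<mu> n)
        \<le> 8 * (1 + \<bar>second_moment p0\<bar>) * exp (- 2 * (1 - \<mu>) * t)"
      unfolding l1_star .
  }
  {
    assume one: "\<mu> = 1"
    with second p0 have sum: "summable (\<lambda>n. pair_weight n * p 0 n)"
      and pm: "pair_moment (p 0) \<le> second_moment p0"
      using pair_moment_le_second_moment[of p0] by (auto simp: init)
    have "2 * crowding (p t) \<le> 8 * (1 + pair_moment (p 0)) / t"
      using critical_crowding_decay[OF sum \<open>0 < t\<close>] one \<mu> by (simp add: init)
    also have "\<dots> \<le> 8 * (1 + \<bar>second_moment p0\<bar>) / t"
      using pm t abs_ge_self[of "second_moment p0"]
      by (intro divide_right_mono mult_left_mono add_left_mono) linarith+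
    finally show "l1_norm (\<lambda>n. p t n - p_star \<mu> n) \<le> 8 * (1 + \<bar>second_moment p0\<bar>) * (1 / t)"
      unfolding l1_star by simp
  }
  {
    assume *: "1 < \<mu> \<and> \<mu> < exp 1 / (exp 1 - 1)"
    have sup: "supercritical_solution p"
      by unfold_locales (use * \<mu> init in simp)
    have "l1_norm (\<lambda>n. p t n - p_bar \<mu> n) \<le> supercritical_const \<mu> * exp (- nu \<mu> * t)"
      using supercritical_solution.slow_emptying_bound[OF sup t] nu_less_1_iff[of \<mu>] * by (simp add: init \<mu>)
    also have "\<dots> \<le> max 1 (supercritical_const \<mu>) * japanese_bracket t powr (1 / 2) * exp (- nu \<mu> * t)"
    proof (rule mult_right_mono)
      have "max 1 (supercritical_const \<mu>) * 1 \<le> max 1 (supercritical_const \<mu>) * japanese_bracket t powr (1 / 2)"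
        using bracket by (intro mult_left_mono ge_one_powr_ge_zero) auto
      then show "supercritical_const \<mu> \<le> max 1 (supercritical_const \<mu>) * japanese_bracket t powr (1 / 2)"
        by simp
    qed simp
    finally show "l1_norm (\<lambda>n. p t n - p_bar \<mu> n)
        \<le> max 1 (supercritical_const \<mu>) * japanese_bracket t powr (1 / 2) * exp (- nu \<mu> * t)" .
  }
  {
    assume *: "exp 1 / (exp 1 - 1) \<le> \<mu>"
    have "1 < exp 1 / (exp 1 - (1 :: real))"
      by (simp add: field_simps)
    from less_le_trans[OF this *] have "1 < \<mu>" .
    have sup: "supercritical_solution p"
      by unfold_locales (use \<open>1 < \<mu>\<close> \<mu> init in simp)
    have "l1_norm (\<lambda>n. p t n - p_bar \<mu> n) \<le> supercritical_const \<mu> * japanese_bracket t * exp (- t)"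
      using supercritical_solution.fast_emptying_bound[OF sup t] nu_less_1_iff[OF \<open>1 < \<mu>\<close>] * by (simp add: init \<mu>)
    also have "\<dots> \<le> max 1 (supercritical_const \<mu>) * japanese_bracket t * exp (- t)"
      using bracket by (intro mult_right_mono) auto
    finally show "l1_norm (\<lambda>n. p t n - p_bar \<mu> n)
        \<le> max 1 (supercritical_const \<mu>) * japanese_bracket t powr (1 / 2 + 1 / 2) * exp (- t)"
      using bracket by simp
  }
qed auto

end
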